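(* Let $\mathcal{C}$ be a monoidal category with regular factorizations and denumerable (i.e. countable) coproducts, and assume that denumerable coproducts as well as regular epimorphisms are preserved by $\otimes$. Then $\mathbf{Mon}\,\mathcal{C}$ has coequalizers and all other colimits which exist in $\mathcal{C}$; that is, for every small category $\mathcal{I}$, if $\mathcal{C}$ has all colimits of shape $\mathcal{I}$, then so does $\mathbf{Mon}\,\mathcal{C}$. In particular, if $\mathcal{C}$ is cocomplete, then so is $\mathbf{Mon}\,\mathcal{C}$.
   Context: $\mathbf{Mon}\,\mathcal{C}$ is the category of monoids in the monoidal category $\mathcal{C}$ and monoid morphisms. "$\otimes$ preserves" a type of colimit (or regular epimorphisms) means that for each object $C$ of $\mathcal{C}$ the functors $C\otimes -$ and $-\otimes C$ preserve them. A category has regular factorizations if every source $(f_i\colon A\to B_i)_{i\in I}$ (where $I$ may be any class) factors as $f_i=m_i\circ e$ with $e\colon A\to E$ a regular epimorphism and $(m_i\colon E\to B_i)_{i\in I}$ a mono-source (a jointly monic family); this is the convention of Adámek–Herrlich–Strecker. *)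

theory Defs
  imports Main
begin

section \<open>Categories and functors\<close>

text \<open>
  Objects and arrows form arbitrary subsets of the types \<open>'o\<close> and \<open>'a\<close>; these sets play the role
  of classes. Composition is written in applicative order and is only meaningful on composable arrows.
\<close>

record ('o, 'a) cat =
  Obj :: "'o set"
  Arr :: "'a set"
  Dom :: "'a \<Rightarrow> 'o"
  Cod :: "'a \<Rightarrow> 'o"
  Ident :: "'o \<Rightarrow> 'a"
  Comp :: "'a \<Rightarrow> 'a \<Rightarrow> 'a"  (infixl "\<cdot>\<index>" 70)

definition hom :: "('o, 'a, 'm) cat_scheme \<Rightarrow> 'o \<Rightarrow> 'o \<Rightarrow> 'a set" where
  "hom C A B = {f \<in> Arr C. Dom C f = A \<and> Cod C f = B}"

locale category =
  fixes C (structure)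
  assumes dom_obj: "f \<in> Arr C \<Longrightarrow> Dom C f \<in> Obj C"
    and cod_obj: "f \<in> Arr C \<Longrightarrow> Cod C f \<in> Obj C"
    and ident_hom: "A \<in> Obj C \<Longrightarrow> Ident C A \<in> hom C A A"
    and comp_hom: "f \<in> hom C X Y \<Longrightarrow> g \<in> hom C Y Z \<Longrightarrow> g \<cdot> f \<in> hom C X Z"
    and comp_ident_left: "f \<in> hom C X Y \<Longrightarrow> Ident C Y \<cdot> f = f"
    and comp_ident_right: "f \<in> hom C X Y \<Longrightarrow> f \<cdot> Ident C X = f"
    and comp_assoc: "f \<in> hom C W X \<Longrightarrow> g \<in> hom C X Y \<Longrightarrow> h \<in> hom C Y Z \<Longrightarrow>
          (h \<cdot> g) \<cdot> f = h \<cdot> (g \<cdot> f)"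

definition is_iso :: "('o, 'a, 'm) cat_scheme \<Rightarrow> 'a \<Rightarrow> bool" where
  "is_iso C f \<longleftrightarrow> f \<in> Arr C \<and>
     (\<exists>g \<in> hom C (Cod C f) (Dom C f).
        g \<cdot>\<^bsub>C\<^esub> f = Ident C (Dom C f) \<and> f \<cdot>\<^bsub>C\<^esub> g = Ident C (Cod C f))"

record ('i, 'j, 'o, 'a) cat_functor =
  FObj :: "'i \<Rightarrow> 'o"
  FArr :: "'j \<Rightarrow> 'a"

definition is_functor ::
  "('i, 'j, 'n) cat_scheme \<Rightarrow> ('o, 'a, 'm) cat_scheme \<Rightarrow> ('i, 'j, 'o, 'a) cat_functor \<Rightarrow> bool" where
  "is_functor J C F \<longleftrightarrow>
     (\<forall>j \<in> Obj J. FObj F j \<in> Obj C \<and> FArr F (Ident J j) = Ident C (FObj F j)) \<and>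
     (\<forall>u \<in> Arr J. FArr F u \<in> hom C (FObj F (Dom J u)) (FObj F (Cod J u))) \<and>
     (\<forall>u \<in> Arr J. \<forall>v \<in> Arr J. Dom J v = Cod J u \<longrightarrow>
        FArr F (v \<cdot>\<^bsub>J\<^esub> u) = FArr F v \<cdot>\<^bsub>C\<^esub> FArr F u)"


section \<open>Colimits\<close>

definition is_cocone ::
  "('i, 'j, 'n) cat_scheme \<Rightarrow> ('o, 'a, 'm) cat_scheme \<Rightarrow> ('i, 'j, 'o, 'a) cat_functor \<Rightarrow>
     'o \<Rightarrow> ('i \<Rightarrow> 'a) \<Rightarrow> bool" where
  "is_cocone J C D Q k \<longleftrightarrow> Q \<in> Obj C \<and>
     (\<forall>j \<in> Obj J. k j \<in> hom C (FObj D j) Q) \<and>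
     (\<forall>u \<in> Arr J. k (Cod J u) \<cdot>\<^bsub>C\<^esub> FArr D u = k (Dom J u))"

definition is_colimit ::
  "('i, 'j, 'n) cat_scheme \<Rightarrow> ('o, 'a, 'm) cat_scheme \<Rightarrow> ('i, 'j, 'o, 'a) cat_functor \<Rightarrow>
     'o \<Rightarrow> ('i \<Rightarrow> 'a) \<Rightarrow> bool" where
  "is_colimit J C D Q k \<longleftrightarrow> is_cocone J C D Q k \<and>
     (\<forall>R l. is_cocone J C D R l \<longrightarrow>
        (\<exists>!h. h \<in> hom C Q R \<and> (\<forall>j \<in> Obj J. h \<cdot>\<^bsub>C\<^esub> k j = l j)))"

definition has_colimits_of_shape ::
  "('i, 'j, 'n) cat_scheme \<Rightarrow> ('o, 'a, 'm) cat_scheme \<Rightarrow> bool" where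
  "has_colimits_of_shape J C \<longleftrightarrow> (\<forall>D. is_functor J C D \<longrightarrow> (\<exists>Q k. is_colimit J C D Q k))"

text \<open>
  HOL has no built-in distinction between sets and proper classes, so the notion of smallness is a
  parameter: \<open>small X\<close> reads ``the class \<open>X\<close> is a set''. Objects and arrows of a small category
  are drawn from one ambient type \<open>'s\<close>.
\<close>

definition small_category :: "('s set \<Rightarrow> bool) \<Rightarrow> ('s, 's) cat \<Rightarrow> bool" where
  "small_category small J \<longleftrightarrow> category J \<and> small (Obj J) \<and> small (Arr J)"

definition cocomplete :: "('s set \<Rightarrow> bool) \<Rightarrow> ('o, 'a, 'm) cat_scheme \<Rightarrow> bool" where
  "cocomplete small C \<longleftrightarrow> (\<forall>J. small_category small J \<longrightarrow> has_colimits_of_shape J C)"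

definition is_coequalizer :: "('o, 'a, 'm) cat_scheme \<Rightarrow> 'a \<Rightarrow> 'a \<Rightarrow> 'a \<Rightarrow> bool" where
  "is_coequalizer C f g q \<longleftrightarrow>
     f \<in> Arr C \<and> g \<in> hom C (Dom C f) (Cod C f) \<and>
     q \<in> Arr C \<and> Dom C q = Cod C f \<and> q \<cdot>\<^bsub>C\<^esub> f = q \<cdot>\<^bsub>C\<^esub> g \<and>
     (\<forall>h \<in> Arr C. Dom C h = Cod C f \<and> h \<cdot>\<^bsub>C\<^esub> f = h \<cdot>\<^bsub>C\<^esub> g \<longrightarrow>
        (\<exists>!k. k \<in> hom C (Cod C q) (Cod C h) \<and> k \<cdot>\<^bsub>C\<^esub> q = h))"

definition has_coequalizers :: "('o, 'a, 'm) cat_scheme \<Rightarrow> bool" where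
  "has_coequalizers C \<longleftrightarrow>
     (\<forall>f \<in> Arr C. \<forall>g \<in> hom C (Dom C f) (Cod C f). \<exists>q. is_coequalizer C f g q)"

definition is_coproduct ::
  "('o, 'a, 'm) cat_scheme \<Rightarrow> 'i set \<Rightarrow> ('i \<Rightarrow> 'o) \<Rightarrow> 'o \<Rightarrow> ('i \<Rightarrow> 'a) \<Rightarrow> bool" where
  "is_coproduct C I X Q k \<longleftrightarrow> Q \<in> Obj C \<and> (\<forall>i \<in> I. X i \<in> Obj C \<and> k i \<in> hom C (X i) Q) \<and>
     (\<forall>R \<in> Obj C. \<forall>l. (\<forall>i \<in> I. l i \<in> hom C (X i) R) \<longrightarrow>
        (\<exists>!h. h \<in> hom C Q R \<and> (\<forall>i \<in> I. h \<cdot>\<^bsub>C\<^esub> k i = l i)))"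

text \<open>
  Countable families are indexed by arbitrary sets of natural numbers, so finite coproducts
  (including the empty one, an initial object) are covered.
\<close>

definition has_countable_coproducts :: "('o, 'a, 'm) cat_scheme \<Rightarrow> bool" where
  "has_countable_coproducts C \<longleftrightarrow>
     (\<forall>(I :: nat set) X. (\<forall>i \<in> I. X i \<in> Obj C) \<longrightarrow> (\<exists>Q k. is_coproduct C I X Q k))"


section \<open>Regular factorizations\<close>

definition regular_epi :: "('o, 'a, 'm) cat_scheme \<Rightarrow> 'a \<Rightarrow> bool" where
  "regular_epi C e \<longleftrightarrow> (\<exists>f g. is_coequalizer C f g e)"

definition is_source :: "('o, 'a, 'm) cat_scheme \<Rightarrow> 'o \<Rightarrow> 'i set \<Rightarrow> ('i \<Rightarrow> 'a) \<Rightarrow> bool" where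
  "is_source C A I f \<longleftrightarrow> A \<in> Obj C \<and> (\<forall>i \<in> I. f i \<in> Arr C \<and> Dom C (f i) = A)"

definition mono_source :: "('o, 'a, 'm) cat_scheme \<Rightarrow> 'o \<Rightarrow> 'i set \<Rightarrow> ('i \<Rightarrow> 'a) \<Rightarrow> bool" where
  "mono_source C A I m \<longleftrightarrow> is_source C A I m \<and>
     (\<forall>r \<in> Arr C. \<forall>s \<in> Arr C. Dom C r = Dom C s \<and> Cod C r = A \<and> Cod C s = A \<and>
        (\<forall>i \<in> I. m i \<cdot>\<^bsub>C\<^esub> r = m i \<cdot>\<^bsub>C\<^esub> s) \<longrightarrow> r = s)"

text \<open>
  Index classes are sets of elements of the arrow type. This is no restriction: a family
  \<open>f\<close> over any index class can be factorized by factorizing the family of its members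
  (the range of \<open>f\<close>, indexed by itself) and reindexing along \<open>f\<close>. Empty sources are included.
\<close>

definition has_regular_factorizations :: "('o, 'a, 'm) cat_scheme \<Rightarrow> bool" where
  "has_regular_factorizations C \<longleftrightarrow>
     (\<forall>A (I :: 'a set) (f :: 'a \<Rightarrow> 'a). is_source C A I f \<longrightarrow>
        (\<exists>E e m. regular_epi C e \<and> e \<in> hom C A E \<and> mono_source C E I m \<and>
           (\<forall>i \<in> I. Cod C (m i) = Cod C (f i) \<and> f i = m i \<cdot>\<^bsub>C\<^esub> e)))"


section \<open>Monoidal categories\<close>

record ('o, 'a) monoidal_cat = "('o, 'a) cat" +
  TObj :: "'o \<Rightarrow> 'o \<Rightarrow> 'o"  (infixr "\<otimes>\<^sub>o\<index>" 75)
  TArr :: "'a \<Rightarrow> 'a \<Rightarrow> 'a"  (infixr "\<otimes>\<index>" 75)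
  Unit :: "'o"  ("\<I>\<index>")
  assoc :: "'o \<Rightarrow> 'o \<Rightarrow> 'o \<Rightarrow> 'a"
  lunit :: "'o \<Rightarrow> 'a"
  runit :: "'o \<Rightarrow> 'a"

locale monoidal_category = category C for C :: "('o, 'a, 'm) monoidal_cat_scheme" (structure) +
  assumes tensor_obj: "X \<in> Obj C \<Longrightarrow> Y \<in> Obj C \<Longrightarrow> X \<otimes>\<^sub>o Y \<in> Obj C"
    and tensor_hom: "f \<in> hom C X X' \<Longrightarrow> g \<in> hom C Y Y' \<Longrightarrow>
          f \<otimes> g \<in> hom C (X \<otimes>\<^sub>o Y) (X' \<otimes>\<^sub>o Y')"
    and tensor_ident: "X \<in> Obj C \<Longrightarrow> Y \<in> Obj C \<Longrightarrow>
          Ident C X \<otimes> Ident C Y = Ident C (X \<otimes>\<^sub>o Y)"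
    and tensor_comp: "f \<in> hom C X X' \<Longrightarrow> f' \<in> hom C X' X'' \<Longrightarrow>
          g \<in> hom C Y Y' \<Longrightarrow> g' \<in> hom C Y' Y'' \<Longrightarrow>
          (f' \<cdot> f) \<otimes> (g' \<cdot> g) = (f' \<otimes> g') \<cdot> (f \<otimes> g)"
    and unit_obj: "\<I> \<in> Obj C"
    and assoc_hom: "X \<in> Obj C \<Longrightarrow> Y \<in> Obj C \<Longrightarrow> Z \<in> Obj C \<Longrightarrow>
          assoc C X Y Z \<in> hom C ((X \<otimes>\<^sub>o Y) \<otimes>\<^sub>o Z) (X \<otimes>\<^sub>o (Y \<otimes>\<^sub>o Z))"
    and assoc_iso: "X \<in> Obj C \<Longrightarrow> Y \<in> Obj C \<Longrightarrow> Z \<in> Obj C \<Longrightarrow> is_iso C (assoc C X Y Z)"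
    and assoc_natural: "f \<in> hom C X X' \<Longrightarrow> g \<in> hom C Y Y' \<Longrightarrow> h \<in> hom C Z Z' \<Longrightarrow>
          assoc C X' Y' Z' \<cdot> ((f \<otimes> g) \<otimes> h) = (f \<otimes> (g \<otimes> h)) \<cdot> assoc C X Y Z"
    and lunit_hom: "X \<in> Obj C \<Longrightarrow> lunit C X \<in> hom C (\<I> \<otimes>\<^sub>o X) X"
    and lunit_iso: "X \<in> Obj C \<Longrightarrow> is_iso C (lunit C X)"
    and lunit_natural: "f \<in> hom C X Y \<Longrightarrow>
          lunit C Y \<cdot> (Ident C \<I> \<otimes> f) = f \<cdot> lunit C X"
    and runit_hom: "X \<in> Obj C \<Longrightarrow> runit C X \<in> hom C (X \<otimes>\<^sub>o \<I>) X"
    and runit_iso: "X \<in> Obj C \<Longrightarrow> is_iso C (runit C X)"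
    and runit_natural: "f \<in> hom C X Y \<Longrightarrow>
          runit C Y \<cdot> (f \<otimes> Ident C \<I>) = f \<cdot> runit C X"
    and pentagon: "W \<in> Obj C \<Longrightarrow> X \<in> Obj C \<Longrightarrow> Y \<in> Obj C \<Longrightarrow> Z \<in> Obj C \<Longrightarrow>
          assoc C W X (Y \<otimes>\<^sub>o Z) \<cdot> assoc C (W \<otimes>\<^sub>o X) Y Z =
          (Ident C W \<otimes> assoc C X Y Z) \<cdot> assoc C W (X \<otimes>\<^sub>o Y) Z \<cdot> (assoc C W X Y \<otimes> Ident C Z)"
    and triangle: "X \<in> Obj C \<Longrightarrow> Y \<in> Obj C \<Longrightarrow>
          (Ident C X \<otimes> lunit C Y) \<cdot> assoc C X \<I> Y = runit C X \<otimes> Ident C Y"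

definition tensor_left ::
  "('o, 'a, 'm) monoidal_cat_scheme \<Rightarrow> 'o \<Rightarrow> ('o, 'a, 'o, 'a) cat_functor" where
  "tensor_left C A = \<lparr>FObj = (\<lambda>X. A \<otimes>\<^sub>o\<^bsub>C\<^esub> X), FArr = (\<lambda>f. Ident C A \<otimes>\<^bsub>C\<^esub> f)\<rparr>"

definition tensor_right ::
  "('o, 'a, 'm) monoidal_cat_scheme \<Rightarrow> 'o \<Rightarrow> ('o, 'a, 'o, 'a) cat_functor" where
  "tensor_right C A = \<lparr>FObj = (\<lambda>X. X \<otimes>\<^sub>o\<^bsub>C\<^esub> A), FArr = (\<lambda>f. f \<otimes>\<^bsub>C\<^esub> Ident C A)\<rparr>"

definition preserves_regular_epis ::
  "('o, 'a, 'm) cat_scheme \<Rightarrow> ('p, 'b, 'n) cat_scheme \<Rightarrow> ('o, 'a, 'p, 'b) cat_functor \<Rightarrow> bool" where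
  "preserves_regular_epis C D F \<longleftrightarrow> (\<forall>e. regular_epi C e \<longrightarrow> regular_epi D (FArr F e))"

definition preserves_countable_coproducts ::
  "('o, 'a, 'm) cat_scheme \<Rightarrow> ('p, 'b, 'n) cat_scheme \<Rightarrow> ('o, 'a, 'p, 'b) cat_functor \<Rightarrow> bool" where
  "preserves_countable_coproducts C D F \<longleftrightarrow>
     (\<forall>(I :: nat set) X Q k. is_coproduct C I X Q k \<longrightarrow>
        is_coproduct D I (\<lambda>i. FObj F (X i)) (FObj F Q) (\<lambda>i. FArr F (k i)))"

definition tensor_preserves_regular_epis :: "('o, 'a, 'm) monoidal_cat_scheme \<Rightarrow> bool" where
  "tensor_preserves_regular_epis C \<longleftrightarrow> (\<forall>A \<in> Obj C.
     preserves_regular_epis C C (tensor_left C A) \<and> preserves_regular_epis C C (tensor_right C A))"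

definition tensor_preserves_countable_coproducts :: "('o, 'a, 'm) monoidal_cat_scheme \<Rightarrow> bool" where
  "tensor_preserves_countable_coproducts C \<longleftrightarrow> (\<forall>A \<in> Obj C.
     preserves_countable_coproducts C C (tensor_left C A) \<and>
     preserves_countable_coproducts C C (tensor_right C A))"


section \<open>The category of monoids\<close>

text \<open>A monoid is a triple \<open>(M, m, e)\<close> of an object, its multiplication and its unit.\<close>

type_synonym ('o, 'a) mon = "'o \<times> 'a \<times> 'a"

definition is_monoid :: "('o, 'a, 'm) monoidal_cat_scheme \<Rightarrow> ('o, 'a) mon \<Rightarrow> bool" where
  "is_monoid C = (\<lambda>(M, m, e). M \<in> Obj C \<and>
     m \<in> hom C (M \<otimes>\<^sub>o\<^bsub>C\<^esub> M) M \<and> e \<in> hom C \<I>\<^bsub>C\<^esub> M \<and>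
     m \<cdot>\<^bsub>C\<^esub> (m \<otimes>\<^bsub>C\<^esub> Ident C M) = m \<cdot>\<^bsub>C\<^esub> (Ident C M \<otimes>\<^bsub>C\<^esub> m) \<cdot>\<^bsub>C\<^esub> assoc C M M M \<and>
     m \<cdot>\<^bsub>C\<^esub> (e \<otimes>\<^bsub>C\<^esub> Ident C M) = lunit C M \<and>
     m \<cdot>\<^bsub>C\<^esub> (Ident C M \<otimes>\<^bsub>C\<^esub> e) = runit C M)"

definition monoid_hom ::
  "('o, 'a, 'm) monoidal_cat_scheme \<Rightarrow> ('o, 'a) mon \<Rightarrow> ('o, 'a) mon \<Rightarrow> 'a \<Rightarrow> bool" where
  "monoid_hom C = (\<lambda>(M, m, e) (N, n, d) f. f \<in> hom C M N \<and>
     f \<cdot>\<^bsub>C\<^esub> m = n \<cdot>\<^bsub>C\<^esub> (f \<otimes>\<^bsub>C\<^esub> f) \<and> f \<cdot>\<^bsub>C\<^esub> e = d)"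

text \<open>
  An arrow of \<open>C\<close> does not determine the monoid structures on its domain and codomain, so arrows
  of \<open>Mon C\<close> carry them along.
\<close>

definition Mon :: "('o, 'a, 'm) monoidal_cat_scheme \<Rightarrow>
    (('o, 'a) mon, ('o, 'a) mon \<times> 'a \<times> ('o, 'a) mon) cat" where
  "Mon C = \<lparr>
     Obj = {M. is_monoid C M},
     Arr = {(M, f, N). is_monoid C M \<and> is_monoid C N \<and> monoid_hom C M N f},
     Dom = (\<lambda>(M, f, N). M),
     Cod = (\<lambda>(M, f, N). N),
     Ident = (\<lambda>M. (M, Ident C (fst M), M)),
     Comp = (\<lambda>(N, g, P) (M, f, N'). (M, g \<cdot>\<^bsub>C\<^esub> f, P))\<rparr>"

end

theory Submission
  imports Defs
begin

text \<open>
The two tools are images of monoids and free monoids; both come from the structure of the monoidal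
category \<open>C\<close>.

Images (lemma \<open>monoid_image\<close>). Regular factorizations lift to monoids. If \<open>e : M \<rightarrow> E\<close> followed by a
mono-source factors a family of monoid morphisms, then \<open>e \<otimes> e\<close> is a composite of the regular
epimorphisms \<open>M \<otimes> e\<close> and \<open>e \<otimes> E\<close>, and such composites are orthogonal to mono-sources. The
multiplication of \<open>E\<close> is the resulting diagonal. As sources of any size can be factored, one may
take the family of \<^emph>\<open>all\<close> monoid morphisms out of \<open>M\<close> that have a prescribed property; the image \<open>E\<close>
is then the universal quotient with that property, whenever the property can be tested by a jointly
monic family. Equalizing a given pair of arrows is such a property, which gives coequalizers.

Free monoids (lemma \<open>free_monoid_exists\<close>). The coproduct of the tensor powers of \<open>X\<close> carries the
free monoid on \<open>X\<close>. To avoid the coherence isomorphisms between \<open>X\<^sup>m \<otimes> X\<^sup>n\<close> and the \<open>(m + n)\<close>-th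
power, this coproduct is only used through the universal property of lists: it admits unique
recursion with a parameter. Concatenation is then defined by recursion, and the monoid laws and the
extension property are proved as in functional programming, by showing that two arrows solve the
same recursion problem. Coherence enters through Kelly's two further unit triangles and, for
associativity, also through the pentagon.

Colimits (lemma \<open>Mon_has_colimits\<close>). Given a diagram of monoids, form the colimit \<open>L\<close> of its
underlying objects in \<open>C\<close>. Cocones of monoids under the diagram correspond to those monoid morphisms
out of the free monoid on \<open>L\<close> whose restrictions to all members of the diagram are monoid morphisms.
This is a property that a jointly monic family tests, so the image under all these morphisms is the
colimit.
\<close>
section \<open>Regular epimorphisms and diagonals\<close>

context category
begin

lemma hom_objs: "f \<in> hom C X Y \<Longrightarrow> X \<in> Obj C" "f \<in> hom C X Y \<Longrightarrow> Y \<in> Obj C"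
  using dom_obj cod_obj by (auto simp: hom_def)

text \<open>
Membership in a hom-set is unfolded into conditions on domain and codomain: the typing
premises of all rules below then mention only the arrows that occur in the term to be rewritten,
so that the simplifier can discharge them.
\<close>
lemma mem_hom [simp]: "f \<in> hom C X Y \<longleftrightarrow> f \<in> Arr C \<and> Dom C f = X \<and> Cod C f = Y"
  by (auto simp: hom_def)

lemma ident_typing [simp]:
  assumes "A \<in> Obj C"
  shows "Ident C A \<in> Arr C" "Dom C (Ident C A) = A" "Cod C (Ident C A) = A"
  using ident_hom[OF assms] by simp_all

lemma comp_typing [simp]:
  assumes "f \<in> Arr C" "g \<in> Arr C" "Dom C g = Cod C f"
  shows "g \<cdot> f \<in> Arr C" "Dom C (g \<cdot> f) = Dom C f" "Cod C (g \<cdot> f) = Cod C g"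
  using comp_hom[of f "Dom C f" "Cod C f" g "Cod C g"] assms by simp_all

declare dom_obj [simp] cod_obj [simp]

lemma ident_comp [simp]:
  "f \<in> Arr C \<Longrightarrow> Cod C f = Y \<Longrightarrow> Ident C Y \<cdot> f = f"
  "f \<in> Arr C \<Longrightarrow> Dom C f = X \<Longrightarrow> f \<cdot> Ident C X = f"
  using comp_ident_left[of f "Dom C f" Y] comp_ident_right[of f X "Cod C f"] by simp_all

lemma comp_assoc_typed [simp]:
  "f \<in> Arr C \<Longrightarrow> g \<in> Arr C \<Longrightarrow> h \<in> Arr C \<Longrightarrow> Dom C g = Cod C f \<Longrightarrow> Dom C h = Cod C g \<Longrightarrow>
    (h \<cdot> g) \<cdot> f = h \<cdot> (g \<cdot> f)"
  by (rule comp_assoc) simp_all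

text \<open>
Composites are kept associated to the right, where an equation \<open>a \<cdot> b = c\<close> does not match an inner
part \<open>a \<cdot> (b \<cdot> x)\<close> of a longer composite; this form does.
\<close>
lemma comp_eq_extend:
  assumes "a \<cdot> b = c" "a \<in> Arr C" "b \<in> Arr C" "x \<in> Arr C" "Dom C a = Cod C b" "Dom C b = Cod C x"
  shows "a \<cdot> (b \<cdot> x) = c \<cdot> x"
  using comp_assoc_typed[of x b a] assms by simp

definition inv_arr :: "'a \<Rightarrow> 'a" where
  "inv_arr f = (SOME g. g \<in> hom C (Cod C f) (Dom C f) \<and>
     g \<cdot> f = Ident C (Dom C f) \<and> f \<cdot> g = Ident C (Cod C f))"

lemma inverse_props:
  assumes "is_iso C f"
  shows "f \<in> Arr C" "inv_arr f \<in> Arr C" "Dom C (inv_arr f) = Cod C f" "Cod C (inv_arr f) = Dom C f"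
    "inv_arr f \<cdot> f = Ident C (Dom C f)" "f \<cdot> inv_arr f = Ident C (Cod C f)"
proof -
  have "\<exists>g. g \<in> hom C (Cod C f) (Dom C f) \<and> g \<cdot> f = Ident C (Dom C f) \<and> f \<cdot> g = Ident C (Cod C f)"
    using assms by (auto simp: is_iso_def)
  from someI_ex[OF this, folded inv_arr_def] show "inv_arr f \<in> Arr C" "Dom C (inv_arr f) = Cod C f" "Cod C (inv_arr f) = Dom C f"
    "inv_arr f \<cdot> f = Ident C (Dom C f)" "f \<cdot> inv_arr f = Ident C (Cod C f)" by simp_all
  show "f \<in> Arr C" using assms by (simp add: is_iso_def)
qed

lemma iso_cancel_left:
  assumes f: "is_iso C f" and "g \<in> Arr C" "h \<in> Arr C" "Cod C g = Dom C f" "Cod C h = Dom C f"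
    and eq: "f \<cdot> g = f \<cdot> h"
  shows "g = h"
proof -
  have "inv_arr f \<cdot> (f \<cdot> g) = g" "inv_arr f \<cdot> (f \<cdot> h) = h"
    using inverse_props[OF f] assms(2-5) by (simp_all flip: comp_assoc_typed)
  then show ?thesis using eq by metis
qed

lemma iso_cancel_right:
  assumes f: "is_iso C f" and "g \<in> Arr C" "h \<in> Arr C" "Dom C g = Cod C f" "Dom C h = Cod C f"
    and eq: "g \<cdot> f = h \<cdot> f"
  shows "g = h"
proof -
  have "(g \<cdot> f) \<cdot> inv_arr f = g" "(h \<cdot> f) \<cdot> inv_arr f = h"
    using inverse_props[OF f] assms(2-5) by simp_all
  then show ?thesis using eq by metis
qed

definition epi :: "'a \<Rightarrow> bool" where
  "epi e \<longleftrightarrow> e \<in> Arr C \<and> (\<forall>g \<in> Arr C. \<forall>h \<in> Arr C.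
     Dom C g = Cod C e \<longrightarrow> Dom C h = Cod C e \<longrightarrow> g \<cdot> e = h \<cdot> e \<longrightarrow> g = h)"

lemma regular_epi_epi:
  assumes "regular_epi C e"
  shows "epi e"
proof -
  obtain f g where *: "is_coequalizer C f g e" using assms by (auto simp: regular_epi_def)
  then have t: "f \<in> Arr C" "g \<in> Arr C" "Dom C g = Dom C f" "Cod C g = Cod C f"
    "e \<in> Arr C" "Dom C e = Cod C f" and ef: "e \<cdot> f = e \<cdot> g"
    by (simp_all add: is_coequalizer_def)
  show ?thesis unfolding epi_def
  proof (intro conjI ballI impI)
    fix a b assume a: "a \<in> Arr C" "b \<in> Arr C" "Dom C a = Cod C e" "Dom C b = Cod C e" and eq: "a \<cdot> e = b \<cdot> e"
    have "Cod C b = Cod C (b \<cdot> e)" using a t by simp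
    also have "\<dots> = Cod C a" unfolding eq[symmetric] using a t by simp
    finally have c: "Cod C b = Cod C a" .
    have "(a \<cdot> e) \<cdot> f = (a \<cdot> e) \<cdot> g" using a t ef by simp
    then have "\<exists>!k. k \<in> hom C (Cod C e) (Cod C (a \<cdot> e)) \<and> k \<cdot> e = a \<cdot> e"
      using * a t unfolding is_coequalizer_def by (metis comp_typing)
    moreover have "a \<in> hom C (Cod C e) (Cod C (a \<cdot> e))" "b \<in> hom C (Cod C e) (Cod C (a \<cdot> e))"
      using a t c by simp_all
    ultimately show "a = b" using eq by metis
  qed (use t in simp)
qed

lemma epi_comp:
  assumes "epi e" "epi d" "Dom C d = Cod C e"
  shows "epi (d \<cdot> e)"
  using assms unfolding epi_def by auto

lemma epiD:
  assumes "epi e" "g \<in> Arr C" "h \<in> Arr C" "Dom C g = Cod C e" "Dom C h = Cod C e" "g \<cdot> e = h \<cdot> e"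
  shows "g = h"
  using assms unfolding epi_def by blast

lemma mono_sourceD:
  assumes "mono_source C E I m" "r \<in> Arr C" "s \<in> Arr C" "Dom C r = Dom C s" "Cod C r = E" "Cod C s = E"
    and "\<And>i. i \<in> I \<Longrightarrow> m i \<cdot> r = m i \<cdot> s"
  shows "r = s"
  using assms unfolding mono_source_def by blast

text \<open>
A regular epimorphism \<open>e\<close> is a coequalizer of some \<open>f\<close> and \<open>g\<close>. If the outer square commutes, the
jointly monic family \<open>m\<close> shows that \<open>u\<close> identifies \<open>f\<close> and \<open>g\<close> too, so \<open>u\<close> factors through \<open>e\<close>.
\<close>
lemma regular_epi_diagonal:
  assumes e: "regular_epi C e" and m: "mono_source C E I m"
    and u: "u \<in> Arr C" "Dom C u = Dom C e" "Cod C u = E"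
    and v: "\<And>i. i \<in> I \<Longrightarrow> v i \<in> Arr C" "\<And>i. i \<in> I \<Longrightarrow> Dom C (v i) = Cod C e"
      "\<And>i. i \<in> I \<Longrightarrow> m i \<cdot> u = v i \<cdot> e"
  shows "\<exists>d \<in> hom C (Cod C e) E. d \<cdot> e = u \<and> (\<forall>i \<in> I. m i \<cdot> d = v i)"
proof -
  obtain f g where *: "is_coequalizer C f g e" using e by (auto simp: regular_epi_def)
  then have t: "f \<in> Arr C" "g \<in> Arr C" "Dom C g = Dom C f" "Cod C g = Cod C f"
    "e \<in> Arr C" "Dom C e = Cod C f" and ef: "e \<cdot> f = e \<cdot> g"
    by (simp_all add: is_coequalizer_def)
  have mt: "m i \<in> Arr C" "Dom C (m i) = E" if "i \<in> I" for i
    using m that by (auto simp: mono_source_def is_source_def)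
  have "u \<cdot> f = u \<cdot> g"
  proof (rule mono_sourceD[OF m])
    fix i assume i: "i \<in> I"
    have "m i \<cdot> (u \<cdot> f) = (m i \<cdot> u) \<cdot> f" using u mt[OF i] t by simp
    also have "\<dots> = v i \<cdot> (e \<cdot> f)" unfolding v(3)[OF i] using v(1,2)[OF i] t by simp
    also have "\<dots> = (m i \<cdot> u) \<cdot> g" unfolding v(3)[OF i] ef using v(1,2)[OF i] t by simp
    also have "\<dots> = m i \<cdot> (u \<cdot> g)" using u mt[OF i] t by simp
    finally show "m i \<cdot> (u \<cdot> f) = m i \<cdot> (u \<cdot> g)" .
  qed (use u t in simp_all)
  moreover have "u \<in> Arr C" "Dom C u = Cod C f" using u t by simp_all
  ultimately obtain d where d: "d \<in> hom C (Cod C e) (Cod C u)" "d \<cdot> e = u"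
    using * unfolding is_coequalizer_def by metis
  have "m i \<cdot> d = v i" if i: "i \<in> I" for i
  proof (rule epiD[OF regular_epi_epi[OF e]])
    have "(m i \<cdot> d) \<cdot> e = m i \<cdot> u" using d mt[OF i] t(5) u(3) by simp
    then show "(m i \<cdot> d) \<cdot> e = v i \<cdot> e" using v(3)[OF i] by simp
  qed (use d v(1,2)[OF i] mt[OF i] u in simp_all)
  then show ?thesis using d u by auto
qed

text \<open>
In a general category regular epimorphisms need not compose, but the diagonal property does. It will
be applied to \<open>e \<otimes> e\<close>, the composite of \<open>M \<otimes> e\<close> and \<open>e \<otimes> E\<close>.
\<close>
lemma regular_epi_comp_diagonal:
  assumes e: "regular_epi C e" and d: "regular_epi C d" "Dom C d = Cod C e"
    and m: "mono_source C E I m"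
    and u: "u \<in> Arr C" "Dom C u = Dom C e" "Cod C u = E"
    and v: "\<And>i. i \<in> I \<Longrightarrow> v i \<in> Arr C" "\<And>i. i \<in> I \<Longrightarrow> Dom C (v i) = Cod C d"
      "\<And>i. i \<in> I \<Longrightarrow> m i \<cdot> u = v i \<cdot> (d \<cdot> e)"
  shows "\<exists>w \<in> hom C (Cod C d) E. w \<cdot> (d \<cdot> e) = u \<and> (\<forall>i \<in> I. m i \<cdot> w = v i)"
proof -
  have t: "e \<in> Arr C" "d \<in> Arr C"
    using regular_epi_epi e d(1) by (auto simp: epi_def)
  have "\<exists>w \<in> hom C (Cod C e) E. w \<cdot> e = u \<and> (\<forall>i \<in> I. m i \<cdot> w = v i \<cdot> d)"
    by (rule regular_epi_diagonal[OF e m u]) (use t d(2) v in simp_all)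
  then obtain w where w: "w \<in> hom C (Cod C e) E" "w \<cdot> e = u" "\<And>i. i \<in> I \<Longrightarrow> m i \<cdot> w = v i \<cdot> d"
    by blast
  have "\<exists>x \<in> hom C (Cod C d) E. x \<cdot> d = w \<and> (\<forall>i \<in> I. m i \<cdot> x = v i)"
    by (rule regular_epi_diagonal[OF d(1) m]) (use w d(2) v(1,2) in simp_all)
  then obtain x where x: "x \<in> hom C (Cod C d) E" "x \<cdot> d = w" "\<And>i. i \<in> I \<Longrightarrow> m i \<cdot> x = v i"
    by blast
  have "x \<cdot> (d \<cdot> e) = u"
    using comp_eq_extend[OF x(2), of e] x(1) w(2) t d(2) by simp
  then show ?thesis using x by blast
qed

end

section \<open>Coherence of unit isomorphisms\<close>

context monoidal_category
begin

lemma tensor_typing [simp]: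
  assumes "f \<in> Arr C" "g \<in> Arr C"
  shows "f \<otimes> g \<in> Arr C" "Dom C (f \<otimes> g) = Dom C f \<otimes>\<^sub>o Dom C g" "Cod C (f \<otimes> g) = Cod C f \<otimes>\<^sub>o Cod C g"
  using tensor_hom[of f "Dom C f" "Cod C f" g "Dom C g" "Cod C g"] assms by simp_all

declare tensor_obj [simp] unit_obj [simp] tensor_ident [simp]

text \<open>
Tensor products are normalized by merging: a composite of tensors becomes a tensor of
composites.
\<close>
lemma interchange [simp]:
  assumes "f \<in> Arr C" "f' \<in> Arr C" "g \<in> Arr C" "g' \<in> Arr C" "Dom C f' = Cod C f" "Dom C g' = Cod C g"
  shows "(f' \<otimes> g') \<cdot> (f \<otimes> g) = (f' \<cdot> f) \<otimes> (g' \<cdot> g)"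
  using tensor_comp[of f "Dom C f" "Cod C f" f' "Cod C f'" g "Dom C g" "Cod C g" g' "Cod C g'"] assms by simp

lemma interchange_chain [simp]:
  assumes "f \<in> Arr C" "f' \<in> Arr C" "g \<in> Arr C" "g' \<in> Arr C" "Dom C f' = Cod C f" "Dom C g' = Cod C g"
    "x \<in> Arr C" "Cod C x = Dom C f \<otimes>\<^sub>o Dom C g"
  shows "(f' \<otimes> g') \<cdot> ((f \<otimes> g) \<cdot> x) = ((f' \<cdot> f) \<otimes> (g' \<cdot> g)) \<cdot> x"
proof -
  have "(f' \<otimes> g') \<cdot> ((f \<otimes> g) \<cdot> x) = ((f' \<otimes> g') \<cdot> (f \<otimes> g)) \<cdot> x"
    using assms by (intro comp_assoc_typed[symmetric]) simp_all
  then show ?thesis using assms by simp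
qed

lemma assoc_typing [simp]:
  assumes "X \<in> Obj C" "Y \<in> Obj C" "Z \<in> Obj C"
  shows "assoc C X Y Z \<in> Arr C" "Dom C (assoc C X Y Z) = (X \<otimes>\<^sub>o Y) \<otimes>\<^sub>o Z"
    "Cod C (assoc C X Y Z) = X \<otimes>\<^sub>o (Y \<otimes>\<^sub>o Z)"
  using assoc_hom[OF assms] by simp_all

lemma unitor_typing [simp]:
  assumes "X \<in> Obj C"
  shows "lunit C X \<in> Arr C" "Dom C (lunit C X) = \<I> \<otimes>\<^sub>o X" "Cod C (lunit C X) = X"
    "runit C X \<in> Arr C" "Dom C (runit C X) = X \<otimes>\<^sub>o \<I>" "Cod C (runit C X) = X"
  using lunit_hom[OF assms] runit_hom[OF assms] by simp_all

lemma inverse_assoc [simp]: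
  assumes "X \<in> Obj C" "Y \<in> Obj C" "Z \<in> Obj C"
  shows "inv_arr (assoc C X Y Z) \<in> Arr C" "Dom C (inv_arr (assoc C X Y Z)) = X \<otimes>\<^sub>o (Y \<otimes>\<^sub>o Z)"
    "Cod C (inv_arr (assoc C X Y Z)) = (X \<otimes>\<^sub>o Y) \<otimes>\<^sub>o Z"
    "inv_arr (assoc C X Y Z) \<cdot> assoc C X Y Z = Ident C ((X \<otimes>\<^sub>o Y) \<otimes>\<^sub>o Z)"
    "assoc C X Y Z \<cdot> inv_arr (assoc C X Y Z) = Ident C (X \<otimes>\<^sub>o (Y \<otimes>\<^sub>o Z))"
  using inverse_props[OF assoc_iso[OF assms]] assms by simp_all

lemma inverse_runit [simp]:
  assumes "X \<in> Obj C"
  shows "inv_arr (runit C X) \<in> Arr C" "Dom C (inv_arr (runit C X)) = X"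
    "Cod C (inv_arr (runit C X)) = X \<otimes>\<^sub>o \<I>"
    "inv_arr (runit C X) \<cdot> runit C X = Ident C (X \<otimes>\<^sub>o \<I>)"
    "runit C X \<cdot> inv_arr (runit C X) = Ident C X"
  using inverse_props[OF runit_iso[OF assms]] assms by simp_all

lemma assoc_nat:
  assumes "f \<in> Arr C" "g \<in> Arr C" "h \<in> Arr C" "Cod C f = X" "Cod C g = Y" "Cod C h = Z"
  shows "assoc C X Y Z \<cdot> ((f \<otimes> g) \<otimes> h) = (f \<otimes> (g \<otimes> h)) \<cdot> assoc C (Dom C f) (Dom C g) (Dom C h)"
  using assms by (intro assoc_natural) simp_all

lemma assoc_nat_chain:
  assumes "f \<in> Arr C" "g \<in> Arr C" "h \<in> Arr C" "Cod C f = X" "Cod C g = Y" "Cod C h = Z"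
    "x \<in> Arr C" "Cod C x = (Dom C f \<otimes>\<^sub>o Dom C g) \<otimes>\<^sub>o Dom C h"
  shows "assoc C X Y Z \<cdot> (((f \<otimes> g) \<otimes> h) \<cdot> x) =
    (f \<otimes> (g \<otimes> h)) \<cdot> (assoc C (Dom C f) (Dom C g) (Dom C h) \<cdot> x)"
proof -
  have t: "X \<in> Obj C" "Y \<in> Obj C" "Z \<in> Obj C" using assms cod_obj by auto
  have "assoc C X Y Z \<cdot> (((f \<otimes> g) \<otimes> h) \<cdot> x) = (assoc C X Y Z \<cdot> ((f \<otimes> g) \<otimes> h)) \<cdot> x"
    using assms t by (intro comp_assoc_typed[symmetric]) simp_all
  also have "\<dots> = ((f \<otimes> (g \<otimes> h)) \<cdot> assoc C (Dom C f) (Dom C g) (Dom C h)) \<cdot> x"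
    by (simp only: assoc_nat[OF assms(1-6)])
  also have "\<dots> = (f \<otimes> (g \<otimes> h)) \<cdot> (assoc C (Dom C f) (Dom C g) (Dom C h) \<cdot> x)"
    using assms by (intro comp_assoc_typed) simp_all
  finally show ?thesis .
qed

lemma lunit_nat: "f \<in> Arr C \<Longrightarrow> Cod C f = Y \<Longrightarrow> lunit C Y \<cdot> (Ident C \<I> \<otimes> f) = f \<cdot> lunit C (Dom C f)"
  and runit_nat: "f \<in> Arr C \<Longrightarrow> Cod C f = Y \<Longrightarrow> runit C Y \<cdot> (f \<otimes> Ident C \<I>) = f \<cdot> runit C (Dom C f)"
  by (rule lunit_natural runit_natural; simp)+

lemma unit_tensor_faithful:
  assumes "f \<in> Arr C" "g \<in> Arr C" "Dom C f = Dom C g" "Cod C f = Cod C g"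
    and eq: "Ident C \<I> \<otimes> f = Ident C \<I> \<otimes> g"
  shows "f = g"
proof (rule iso_cancel_right[OF lunit_iso[of "Dom C f"]])
  show "f \<cdot> lunit C (Dom C f) = g \<cdot> lunit C (Dom C f)"
    using lunit_nat[of f] lunit_nat[of g] assms by simp
qed (use assms in simp_all)

lemma tensor_unit_faithful:
  assumes "f \<in> Arr C" "g \<in> Arr C" "Dom C f = Dom C g" "Cod C f = Cod C g"
    and eq: "f \<otimes> Ident C \<I> = g \<otimes> Ident C \<I>"
  shows "f = g"
proof (rule iso_cancel_right[OF runit_iso[of "Dom C f"]])
  show "f \<cdot> runit C (Dom C f) = g \<cdot> runit C (Dom C f)"
    using runit_nat[of f] runit_nat[of g] assms by simp
qed (use assms in simp_all)

lemma is_iso_tensor_ident: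
  assumes f: "is_iso C f" and X: "X \<in> Obj C"
  shows "is_iso C (f \<otimes> Ident C X)"
  unfolding is_iso_def
  using inverse_props[OF f] X by (auto intro!: bexI[of _ "inv_arr f \<otimes> Ident C X"])

text \<open>
The unit triangles with the unit in first or last position are not axioms but theorems of Kelly.
For the first one: since \<open>\<I> \<otimes> -\<close> is faithful, it suffices to compare both sides after applying it;
there the pentagon for \<open>\<I>, \<I>, X, Y\<close> reduces the claim to two instances of the axiomatic triangle.
\<close>
lemma lunit_tensor:
  assumes X [simp]: "X \<in> Obj C" and Y [simp]: "Y \<in> Obj C"
  shows "lunit C (X \<otimes>\<^sub>o Y) \<cdot> assoc C \<I> X Y = lunit C X \<otimes> Ident C Y"
proof (rule unit_tensor_faithful)
  let ?k = "assoc C \<I> (\<I> \<otimes>\<^sub>o X) Y" and ?l = "assoc C \<I> \<I> X \<otimes> Ident C Y"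
  have iso: "is_iso C ?k" "is_iso C ?l"
    by (simp_all add: assoc_iso is_iso_tensor_ident)
  have "((Ident C \<I> \<otimes> (lunit C (X \<otimes>\<^sub>o Y) \<cdot> assoc C \<I> X Y)) \<cdot> ?k) \<cdot> ?l
      = (Ident C \<I> \<otimes> lunit C (X \<otimes>\<^sub>o Y)) \<cdot> ((Ident C \<I> \<otimes> assoc C \<I> X Y) \<cdot> ?k \<cdot> ?l)"
    by simp
  also have "\<dots> = ((Ident C \<I> \<otimes> lunit C (X \<otimes>\<^sub>o Y)) \<cdot> assoc C \<I> \<I> (X \<otimes>\<^sub>o Y)) \<cdot> assoc C (\<I> \<otimes>\<^sub>o \<I>) X Y"
    by (subst pentagon[symmetric]) (simp_all del: interchange)
  also have "\<dots> = (runit C \<I> \<otimes> (Ident C X \<otimes> Ident C Y)) \<cdot> assoc C (\<I> \<otimes>\<^sub>o \<I>) X Y"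
    by (subst triangle) simp_all
  also have "\<dots> = assoc C \<I> X Y \<cdot> ((runit C \<I> \<otimes> Ident C X) \<otimes> Ident C Y)"
    by (subst assoc_nat) simp_all
  also have "\<dots> = assoc C \<I> X Y \<cdot> (((Ident C \<I> \<otimes> lunit C X) \<otimes> Ident C Y) \<cdot> ?l)"
    by (subst triangle[symmetric]) simp_all
  also have "\<dots> = ((Ident C \<I> \<otimes> (lunit C X \<otimes> Ident C Y)) \<cdot> ?k) \<cdot> ?l"
    by (subst assoc_nat_chain) simp_all
  finally have "(Ident C \<I> \<otimes> (lunit C (X \<otimes>\<^sub>o Y) \<cdot> assoc C \<I> X Y)) \<cdot> ?k
      = (Ident C \<I> \<otimes> (lunit C X \<otimes> Ident C Y)) \<cdot> ?k"
    by (rule iso_cancel_right[OF iso(2), rotated -1]) simp_all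
  then show "Ident C \<I> \<otimes> (lunit C (X \<otimes>\<^sub>o Y) \<cdot> assoc C \<I> X Y) = Ident C \<I> \<otimes> (lunit C X \<otimes> Ident C Y)"
    by (rule iso_cancel_right[OF iso(1), rotated -1]) simp_all
qed simp_all

text \<open>
The mirror image of the previous argument: \<open>- \<otimes> \<I>\<close> is faithful, and the pentagon is the one for
\<open>X, Y, \<I>, \<I>\<close>.
\<close>
lemma runit_tensor:
  assumes X [simp]: "X \<in> Obj C" and Y [simp]: "Y \<in> Obj C"
  shows "(Ident C X \<otimes> runit C Y) \<cdot> assoc C X Y \<I> = runit C (X \<otimes>\<^sub>o Y)"
proof (rule tensor_unit_faithful)
  let ?r = "(Ident C X \<otimes> runit C Y) \<cdot> assoc C X Y \<I>"
  let ?I = "Ident C \<I>"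
  have "assoc C X Y \<I> \<cdot> (?r \<otimes> ?I)
      = assoc C X Y \<I> \<cdot> (((Ident C X \<otimes> runit C Y) \<otimes> ?I) \<cdot> (assoc C X Y \<I> \<otimes> ?I))"
    by simp
  also have "\<dots> = (Ident C X \<otimes> (runit C Y \<otimes> ?I)) \<cdot> (assoc C X (Y \<otimes>\<^sub>o \<I>) \<I> \<cdot> (assoc C X Y \<I> \<otimes> ?I))"
    by (subst assoc_nat_chain) simp_all
  also have "\<dots> = (Ident C X \<otimes> (Ident C Y \<otimes> lunit C \<I>)) \<cdot>
      ((Ident C X \<otimes> assoc C Y \<I> \<I>) \<cdot> assoc C X (Y \<otimes>\<^sub>o \<I>) \<I> \<cdot> (assoc C X Y \<I> \<otimes> ?I))"
    by (subst triangle[symmetric]) simp_all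
  also have "\<dots> = (Ident C X \<otimes> (Ident C Y \<otimes> lunit C \<I>)) \<cdot>
      (assoc C X Y (\<I> \<otimes>\<^sub>o \<I>) \<cdot> assoc C (X \<otimes>\<^sub>o Y) \<I> \<I>)"
    by (subst pentagon[symmetric]) simp_all
  also have "\<dots> = assoc C X Y \<I> \<cdot> (((Ident C X \<otimes> Ident C Y) \<otimes> lunit C \<I>) \<cdot> assoc C (X \<otimes>\<^sub>o Y) \<I> \<I>)"
    by (subst assoc_nat_chain) simp_all
  also have "\<dots> = assoc C X Y \<I> \<cdot> (runit C (X \<otimes>\<^sub>o Y) \<otimes> ?I)"
    by (subst triangle[symmetric]) simp_all
  finally show "?r \<otimes> ?I = runit C (X \<otimes>\<^sub>o Y) \<otimes> ?I"
    by (rule iso_cancel_left[OF assoc_iso[of X Y \<I>], rotated -1]) simp_all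
qed simp_all

text \<open>
Naturality of \<open>lunit\<close> at \<open>lunit \<I>\<close> identifies \<open>lunit (\<I> \<otimes> \<I>)\<close> with \<open>\<I> \<otimes> lunit \<I>\<close>; then two of the
triangles give \<open>lunit \<I> \<otimes> \<I> = runit \<I> \<otimes> \<I>\<close>.
\<close>
lemma lunit_unit: "lunit C \<I> = runit C \<I>"
proof (rule tensor_unit_faithful)
  have "lunit C (\<I> \<otimes>\<^sub>o \<I>) = Ident C \<I> \<otimes> lunit C \<I>"
    by (rule iso_cancel_left[OF lunit_iso[of \<I>]]) (simp_all add: lunit_nat)
  then show "lunit C \<I> \<otimes> Ident C \<I> = runit C \<I> \<otimes> Ident C \<I>"
    using lunit_tensor[of \<I> \<I>] triangle[of \<I> \<I>] by simp
qed simp_all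

end

section \<open>Images of monoids\<close>

context monoidal_category
begin

lemma monoidD:
  assumes "is_monoid C (M, m, u)"
  shows "M \<in> Obj C" "m \<in> Arr C" "Dom C m = M \<otimes>\<^sub>o M" "Cod C m = M"
    "u \<in> Arr C" "Dom C u = \<I>" "Cod C u = M"
    "m \<cdot> (m \<otimes> Ident C M) = m \<cdot> ((Ident C M \<otimes> m) \<cdot> assoc C M M M)"
    "m \<cdot> (u \<otimes> Ident C M) = lunit C M"
    "m \<cdot> (Ident C M \<otimes> u) = runit C M"
  using assms by (auto simp: is_monoid_def)

lemma monoidI:
  assumes "M \<in> Obj C" "m \<in> Arr C" "Dom C m = M \<otimes>\<^sub>o M" "Cod C m = M"
    "u \<in> Arr C" "Dom C u = \<I>" "Cod C u = M"
    "m \<cdot> (m \<otimes> Ident C M) = m \<cdot> ((Ident C M \<otimes> m) \<cdot> assoc C M M M)"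
    "m \<cdot> (u \<otimes> Ident C M) = lunit C M"
    "m \<cdot> (Ident C M \<otimes> u) = runit C M"
  shows "is_monoid C (M, m, u)"
  using assms by (auto simp: is_monoid_def)

lemma monoid_hom_iff:
  "monoid_hom C (M, m, u) (N, n, v) f \<longleftrightarrow>
     f \<in> Arr C \<and> Dom C f = M \<and> Cod C f = N \<and> f \<cdot> m = n \<cdot> (f \<otimes> f) \<and> f \<cdot> u = v"
  by (auto simp: monoid_hom_def)

text \<open>
A multiplicative epimorphism \<open>e\<close> carries the monoid equations from \<open>M\<close> to \<open>E\<close>, provided that both
sides of each equation can be compared after precomposition with the tensor of copies of \<open>e\<close> in
question.
\<close>
lemma quotient_is_monoid:
  assumes M: "is_monoid C (M, m, u)"
    and e: "e \<in> Arr C" "Dom C e = M" "Cod C e = E"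
    and n: "n \<in> Arr C" "Dom C n = E \<otimes>\<^sub>o E" "Cod C n = E"
    and ne: "n \<cdot> (e \<otimes> e) = e \<cdot> m"
    and epi_left: "epi (Ident C \<I> \<otimes> e)" and epi_right: "epi (e \<otimes> Ident C \<I>)"
    and epi3: "epi ((e \<otimes> e) \<otimes> e)"
  shows "is_monoid C (E, n, e \<cdot> u)"
proof -
  note M' [simp] = monoidD(1-7)[OF M]
  note [simp] = e n
  have E [simp]: "E \<in> Obj C" using cod_obj[of e] by simp
  have split: "(e \<cdot> x) \<otimes> (e \<cdot> y) = (e \<otimes> e) \<cdot> (x \<otimes> y)"
    if "x \<in> Arr C" "Cod C x = M" "y \<in> Arr C" "Cod C y = M" for x y
    using that by simp
  have ne': "n \<cdot> ((e \<cdot> x) \<otimes> (e \<cdot> y)) = e \<cdot> (m \<cdot> (x \<otimes> y))"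
    if "x \<in> Arr C" "Cod C x = M" "y \<in> Arr C" "Cod C y = M" for x y
    unfolding split[OF that] using comp_eq_extend[OF ne, of "x \<otimes> y"] that by simp
  note ne1 = ne'[of _ "Ident C M"] and ne2 = ne'[of "Ident C M"]
  show ?thesis
  proof (rule monoidI)
    show "n \<cdot> (n \<otimes> Ident C E) = n \<cdot> ((Ident C E \<otimes> n) \<cdot> assoc C E E E)"
    proof (rule epiD[OF epi3])
      have "(n \<cdot> (n \<otimes> Ident C E)) \<cdot> ((e \<otimes> e) \<otimes> e) = n \<cdot> ((e \<cdot> m) \<otimes> e)" by (simp add: ne)
      also have "\<dots> = e \<cdot> (m \<cdot> (m \<otimes> Ident C M))" using ne1[of m] by simp
      also have "\<dots> = (e \<cdot> (m \<cdot> (Ident C M \<otimes> m))) \<cdot> assoc C M M M" by (simp add: monoidD(8)[OF M])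
      also have "e \<cdot> (m \<cdot> (Ident C M \<otimes> m)) = n \<cdot> (e \<otimes> (e \<cdot> m))" using ne2[of m] by simp
      also have "(n \<cdot> (e \<otimes> (e \<cdot> m))) \<cdot> assoc C M M M
          = n \<cdot> ((Ident C E \<otimes> n) \<cdot> ((e \<otimes> (e \<otimes> e)) \<cdot> assoc C M M M))" by (simp add: ne)
      also have "\<dots> = n \<cdot> ((Ident C E \<otimes> n) \<cdot> (assoc C E E E \<cdot> ((e \<otimes> e) \<otimes> e)))"
        by (simp add: assoc_nat del: interchange interchange_chain)
      also have "\<dots> = (n \<cdot> ((Ident C E \<otimes> n) \<cdot> assoc C E E E)) \<cdot> ((e \<otimes> e) \<otimes> e)" by simp
      finally show "(n \<cdot> (n \<otimes> Ident C E)) \<cdot> ((e \<otimes> e) \<otimes> e) =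
        (n \<cdot> ((Ident C E \<otimes> n) \<cdot> assoc C E E E)) \<cdot> ((e \<otimes> e) \<otimes> e)" .
    qed simp_all
    show "n \<cdot> ((e \<cdot> u) \<otimes> Ident C E) = lunit C E"
    proof (rule epiD[OF epi_left])
      have "(n \<cdot> ((e \<cdot> u) \<otimes> Ident C E)) \<cdot> (Ident C \<I> \<otimes> e) = n \<cdot> ((e \<cdot> u) \<otimes> e)" by simp
      also have "\<dots> = e \<cdot> lunit C M" using ne1[of u] by (simp add: monoidD(9)[OF M])
      finally show "(n \<cdot> ((e \<cdot> u) \<otimes> Ident C E)) \<cdot> (Ident C \<I> \<otimes> e) = lunit C E \<cdot> (Ident C \<I> \<otimes> e)"
        by (simp add: lunit_nat)
    qed simp_all
    show "n \<cdot> (Ident C E \<otimes> (e \<cdot> u)) = runit C E"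
    proof (rule epiD[OF epi_right])
      have "(n \<cdot> (Ident C E \<otimes> (e \<cdot> u))) \<cdot> (e \<otimes> Ident C \<I>) = n \<cdot> (e \<otimes> (e \<cdot> u))" by simp
      also have "\<dots> = e \<cdot> runit C M" using ne2[of u] by (simp add: monoidD(10)[OF M])
      finally show "(n \<cdot> (Ident C E \<otimes> (e \<cdot> u))) \<cdot> (e \<otimes> Ident C \<I>) = runit C E \<cdot> (e \<otimes> Ident C \<I>)"
        by (simp add: runit_nat)
    qed simp_all
  qed simp_all
qed

lemma monoid_hom_typing:
  assumes "monoid_hom C M N f"
  shows "f \<in> Arr C" "Dom C f = fst M" "Cod C f = fst N"
  using assms by (cases M; cases N; simp add: monoid_hom_iff)+

lemma monoid_homI:
  assumes "is_monoid C M" "is_monoid C E"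
    and "r \<in> Arr C" "Dom C r = fst M" "Cod C r = fst E"
    and "r \<cdot> fst (snd M) = fst (snd E) \<cdot> (r \<otimes> r)" "r \<cdot> snd (snd M) = snd (snd E)"
  shows "monoid_hom C M E r"
  using assms by (cases M; cases E; simp add: monoid_hom_iff)

lemma monoid_typing:
  assumes "is_monoid C M"
  shows "fst M \<in> Obj C" "fst (snd M) \<in> Arr C" "Dom C (fst (snd M)) = fst M \<otimes>\<^sub>o fst M" "Cod C (fst (snd M)) = fst M"
    "snd (snd M) \<in> Arr C" "Dom C (snd (snd M)) = \<I>" "Cod C (snd (snd M)) = fst M"
  using monoidD(1-7)[of "fst M" "fst (snd M)" "snd (snd M)"] assms by simp_all

lemma monoid_hom_comp:
  assumes "monoid_hom C M N f" "monoid_hom C N P g" "is_monoid C M" "is_monoid C N" "is_monoid C P"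
  shows "monoid_hom C M P (g \<cdot> f)"
proof -
  obtain M0 m u N0 n v P0 p w where MNP: "M = (M0, m, u)" "N = (N0, n, v)" "P = (P0, p, w)"
    by (metis prod_cases3)
  note [simp] = monoidD(1-7)[OF assms(3)[unfolded MNP]] monoidD(1-7)[OF assms(4)[unfolded MNP]]
    monoidD(1-7)[OF assms(5)[unfolded MNP]]
  note f = assms(1)[unfolded MNP monoid_hom_iff] and g = assms(2)[unfolded MNP monoid_hom_iff]
  have ft [simp]: "f \<in> Arr C" "Dom C f = M0" "Cod C f = N0" using f by simp_all
  have gt [simp]: "g \<in> Arr C" "Dom C g = N0" "Cod C g = P0" using g by simp_all
  have fm: "f \<cdot> m = n \<cdot> (f \<otimes> f)" "f \<cdot> u = v" and gm: "g \<cdot> n = p \<cdot> (g \<otimes> g)" "g \<cdot> v = w"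
    using f g by simp_all
  have "g \<cdot> (f \<cdot> m) = p \<cdot> ((g \<cdot> f) \<otimes> (g \<cdot> f))"
    unfolding fm using comp_eq_extend[OF gm(1), of "f \<otimes> f"] by simp
  then show ?thesis unfolding MNP monoid_hom_iff by (simp add: fm gm)
qed

text \<open>
If \<open>k\<close> and \<open>k \<cdot> r\<close> are monoid morphisms, then the two equations that make \<open>r\<close> a monoid morphism
hold after composing with \<open>k\<close>. Hence \<open>r\<close> is a monoid morphism as soon as it is tested against a
jointly monic family of such \<open>k\<close>.
\<close>
lemma monoid_hom_reflect:
  assumes k: "monoid_hom C E N k" and kr: "monoid_hom C M N (k \<cdot> r)"
    and r: "r \<in> Arr C" "Dom C r = fst M" "Cod C r = fst E"
    and mon: "is_monoid C M" "is_monoid C E" "is_monoid C N"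
  shows "k \<cdot> (r \<cdot> fst (snd M)) = k \<cdot> (fst (snd E) \<cdot> (r \<otimes> r))"
    and "k \<cdot> (r \<cdot> snd (snd M)) = k \<cdot> snd (snd E)"
proof -
  obtain M0 m u N0 n v P0 p w where MNP: "M = (M0, m, u)" "N = (N0, n, v)" "E = (P0, p, w)"
    by (metis prod_cases3)
  note [simp] = monoidD(1-7)[OF mon(1)[unfolded MNP]] monoidD(1-7)[OF mon(2)[unfolded MNP]]
    monoidD(1-7)[OF mon(3)[unfolded MNP]]
  have rt [simp]: "r \<in> Arr C" "Dom C r = M0" "Cod C r = P0" using r by (simp_all add: MNP)
  have kt [simp]: "k \<in> Arr C" "Dom C k = P0" "Cod C k = N0"
    and km: "k \<cdot> p = n \<cdot> (k \<otimes> k)" "k \<cdot> w = v"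
    using k by (simp_all add: MNP monoid_hom_iff)
  have krm: "k \<cdot> (r \<cdot> m) = n \<cdot> ((k \<cdot> r) \<otimes> (k \<cdot> r))" "k \<cdot> (r \<cdot> u) = v"
    using kr by (simp_all add: MNP monoid_hom_iff)
  show "k \<cdot> (r \<cdot> fst (snd M)) = k \<cdot> (fst (snd E) \<cdot> (r \<otimes> r))"
    using krm comp_eq_extend[OF km(1), of "r \<otimes> r"] by (simp add: MNP)
  show "k \<cdot> (r \<cdot> snd (snd M)) = k \<cdot> snd (snd E)"
    using krm km by (simp add: MNP)
qed

end

locale regular_monoidal_category = monoidal_category +
  assumes factorizations: "has_regular_factorizations C"
    and tensor_regular: "tensor_preserves_regular_epis C"
begin

lemma regular_epi_tensor:
  assumes "regular_epi C e" "X \<in> Obj C"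
  shows "regular_epi C (Ident C X \<otimes> e)" "regular_epi C (e \<otimes> Ident C X)"
  using assms tensor_regular
  by (simp_all add: tensor_preserves_regular_epis_def preserves_regular_epis_def
      tensor_left_def tensor_right_def)

text \<open>
The family \<open>S\<close> of monoid morphisms out of \<open>M\<close> factors through one monoid \<open>E\<close> by an epimorphism
of \<open>C\<close> followed by a jointly monic family of monoid morphisms. The factorization is that of the
underlying arrows, and the multiplication of \<open>E\<close> is a diagonal: \<open>e \<otimes> e\<close> is a composite of regular
epimorphisms, while the second factors \<open>k h\<close> form a mono-source. In the last clause \<open>k\<close> is
determined by \<open>h\<close>, because \<open>e\<close> is epi.
\<close>
lemma monoid_image:
  assumes M: "is_monoid C M"
    and S: "\<And>h N. (h, N) \<in> S \<Longrightarrow> is_monoid C N \<and> monoid_hom C M N h"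
  obtains E e where "is_monoid C E" "monoid_hom C M E e" "epi e"
    "\<And>h N. (h, N) \<in> S \<Longrightarrow> \<exists>k. monoid_hom C E N k \<and> k \<cdot> e = h"
    "\<And>r s. r \<in> Arr C \<Longrightarrow> s \<in> Arr C \<Longrightarrow> Dom C r = Dom C s \<Longrightarrow> Cod C r = fst E \<Longrightarrow> Cod C s = fst E \<Longrightarrow>
       (\<And>h N k. (h, N) \<in> S \<Longrightarrow> monoid_hom C E N k \<Longrightarrow> k \<cdot> e = h \<Longrightarrow> k \<cdot> r = k \<cdot> s) \<Longrightarrow> r = s"
proof -
  obtain M0 m u where M_def: "M = (M0, m, u)" by (metis prod_cases3)
  note M' [simp] = monoidD(1-7)[OF M[unfolded M_def]]
  have S_hom: "h \<in> Arr C" "Dom C h = M0" if "(h, N) \<in> S" for h N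
    using S[OF that] by (cases N; simp add: M_def monoid_hom_iff)+
  have "is_source C M0 (fst ` S) id"
    using S_hom by (auto simp: is_source_def)
  then obtain E e k where e: "regular_epi C e" "e \<in> hom C M0 E" and mono: "mono_source C E (fst ` S) k"
    and fact: "\<And>h. h \<in> fst ` S \<Longrightarrow> Cod C (k h) = Cod C h \<and> h = k h \<cdot> e"
    using factorizations[unfolded has_regular_factorizations_def, rule_format, of M0 "fst ` S" id]
    by (metis id_apply)
  note [simp] = e(2)[unfolded mem_hom, THEN conjunct1]
    e(2)[unfolded mem_hom, THEN conjunct2, THEN conjunct1]
    e(2)[unfolded mem_hom, THEN conjunct2, THEN conjunct2]
  have E [simp]: "E \<in> Obj C" using cod_obj[of e] by simp
  have kt: "k h \<in> Arr C" "Dom C (k h) = E" if "h \<in> fst ` S" for h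
    using mono that by (auto simp: mono_source_def is_source_def)
  have epi_e: "epi e" by (rule regular_epi_epi[OF e(1)])
  have epi_e_id: "epi (e \<otimes> Ident C X)" and epi_id_e: "epi (Ident C X \<otimes> e)" if "X \<in> Obj C" for X
    using regular_epi_tensor[OF e(1) that] regular_epi_epi by blast+
  have epi_ee: "epi (e \<otimes> e)"
    using epi_comp[OF epi_id_e[of M0] epi_e_id[of E]] by simp
  have epi_eee: "epi ((e \<otimes> e) \<otimes> e)"
  proof -
    have "epi (((e \<otimes> Ident C E) \<otimes> Ident C E) \<cdot> (((Ident C M0 \<otimes> e) \<otimes> Ident C E) \<cdot> ((Ident C M0 \<otimes> Ident C M0) \<otimes> e)))"
      using regular_epi_tensor e(1)
      by (intro epi_comp regular_epi_epi) simp_all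
    then show ?thesis by simp
  qed
  have kS: "k h \<cdot> (e \<cdot> m) = n \<cdot> ((k h \<otimes> k h) \<cdot> (e \<otimes> e)) \<and> k h \<cdot> (e \<cdot> u) = v
      \<and> Cod C (k h) = N0 \<and> n \<in> Arr C \<and> Dom C n = N0 \<otimes>\<^sub>o N0 \<and> Cod C n = N0"
    if "(h, N0, n, v) \<in> S" for h N0 n v
  proof -
    have hS: "h \<in> fst ` S" using that by force
    have h: "h \<cdot> m = n \<cdot> (h \<otimes> h)" "h \<cdot> u = v" "Cod C h = N0"
      using S[OF that] by (simp_all add: M_def monoid_hom_iff)
    have n: "n \<in> Arr C" "Dom C n = N0 \<otimes>\<^sub>o N0" "Cod C n = N0" using S[OF that] monoidD by blast+
    have ke: "k h \<cdot> e = h" using fact[OF hS] by simp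
    have "k h \<cdot> (e \<cdot> m) = h \<cdot> m" "k h \<cdot> (e \<cdot> u) = h \<cdot> u"
      using comp_eq_extend[OF ke] kt[OF hS] by simp_all
    then show ?thesis using h n fact[OF hS] kt[OF hS] by (simp add: ke)
  qed
  \<comment> \<open>One arrow may be a morphism for several monoid structures on its codomain, but the source is
    indexed by arrows. One structure for each arrow is enough to obtain the multiplication; since
    \<open>e \<otimes> e\<close> is epi, the factors are then morphisms for all the others.\<close>
  define str where "str h = (SOME N. (h, N) \<in> S)" for h
  have str: "(h, str h) \<in> S" if "h \<in> fst ` S" for h
    using that unfolding str_def by (auto intro: someI)
  have ee: "(e \<otimes> Ident C E) \<cdot> (Ident C M0 \<otimes> e) = e \<otimes> e" by simp
  have "\<exists>n \<in> hom C (Cod C (e \<otimes> Ident C E)) E. n \<cdot> ((e \<otimes> Ident C E) \<cdot> (Ident C M0 \<otimes> e)) = e \<cdot> m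
      \<and> (\<forall>h \<in> fst ` S. k h \<cdot> n = fst (snd (str h)) \<cdot> (k h \<otimes> k h))"
  proof (rule regular_epi_comp_diagonal[OF _ _ _ mono])
    fix h assume h: "h \<in> fst ` S"
    obtain N0 n v where N: "str h = (N0, n, v)" by (metis prod_cases3)
    note * = kS[OF str[OF h, unfolded N]] kt[OF h]
    show "fst (snd (str h)) \<cdot> (k h \<otimes> k h) \<in> Arr C"
      "Dom C (fst (snd (str h)) \<cdot> (k h \<otimes> k h)) = Cod C (e \<otimes> Ident C E)"
      "k h \<cdot> (e \<cdot> m) = (fst (snd (str h)) \<cdot> (k h \<otimes> k h)) \<cdot> ((e \<otimes> Ident C E) \<cdot> (Ident C M0 \<otimes> e))"
      unfolding N using * by simp_all
  qed (use regular_epi_tensor e(1) in simp_all)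
  then obtain n where n [simp]: "n \<in> Arr C" "Dom C n = E \<otimes>\<^sub>o E" "Cod C n = E" and ne: "n \<cdot> (e \<otimes> e) = e \<cdot> m"
    unfolding ee by auto
  let ?E = "(E, n, e \<cdot> u)"
  have E_mon: "is_monoid C ?E"
    by (rule quotient_is_monoid[OF M[unfolded M_def] _ _ _ _ _ _ ne])
      (simp_all add: epi_e_id epi_id_e epi_eee)
  have e_hom: "monoid_hom C M ?E e"
    by (simp add: M_def monoid_hom_iff ne)
  have k_hom: "monoid_hom C ?E N (k h) \<and> k h \<cdot> e = h" if hN: "(h, N) \<in> S" for h N
  proof -
    obtain N0 n' v where N: "N = (N0, n', v)" by (metis prod_cases3)
    have hS: "h \<in> fst ` S" using that by force
    note * = kS[OF hN[unfolded N]] kt[OF hS]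
    have "k h \<cdot> n = n' \<cdot> (k h \<otimes> k h)"
    proof (rule epiD[OF epi_ee])
      show "(k h \<cdot> n) \<cdot> (e \<otimes> e) = (n' \<cdot> (k h \<otimes> k h)) \<cdot> (e \<otimes> e)"
        using * ne by simp
    qed (use * in simp_all)
    then show ?thesis using * fact[OF hS] by (simp add: N monoid_hom_iff)
  qed
  show thesis
  proof (rule that[OF E_mon e_hom epi_e])
    show "\<exists>k. monoid_hom C ?E N k \<and> k \<cdot> e = h" if "(h, N) \<in> S" for h N
      using k_hom[OF that] by blast
  next
    fix r s assume rs: "r \<in> Arr C" "s \<in> Arr C" "Dom C r = Dom C s" "Cod C r = fst ?E" "Cod C s = fst ?E"
      and eq: "\<And>h N k. (h, N) \<in> S \<Longrightarrow> monoid_hom C ?E N k \<Longrightarrow> k \<cdot> e = h \<Longrightarrow> k \<cdot> r = k \<cdot> s"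
    show "r = s"
    proof (rule mono_sourceD[OF mono])
      fix h assume "h \<in> fst ` S"
      from str[OF this] show "k h \<cdot> r = k h \<cdot> s" using eq k_hom by blast
    qed (use rs in simp_all)
  qed
qed

end

section \<open>List objects and free monoids\<close>

text \<open>
The equations of a recursion over lists with a parameter \<open>y\<close>: informally, \<open>h (nil, y) = g y\<close> and
\<open>h (cons x xs, y) = a (x, h (xs, y))\<close>.
\<close>
definition parametrized_rec ::
  "('o, 'a, 'm) monoidal_cat_scheme \<Rightarrow> 'o \<Rightarrow> 'o \<Rightarrow> 'a \<Rightarrow> 'a \<Rightarrow> 'a \<Rightarrow> 'a \<Rightarrow> 'a \<Rightarrow> bool" where
  "parametrized_rec C X L nil cons g a h \<longleftrightarrow>
     h \<in> hom C (L \<otimes>\<^sub>o\<^bsub>C\<^esub> Dom C g) (Cod C g) \<and>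
     h \<cdot>\<^bsub>C\<^esub> (nil \<otimes>\<^bsub>C\<^esub> Ident C (Dom C g)) = g \<cdot>\<^bsub>C\<^esub> lunit C (Dom C g) \<and>
     h \<cdot>\<^bsub>C\<^esub> (cons \<otimes>\<^bsub>C\<^esub> Ident C (Dom C g)) =
       a \<cdot>\<^bsub>C\<^esub> ((Ident C X \<otimes>\<^bsub>C\<^esub> h) \<cdot>\<^bsub>C\<^esub> assoc C X L (Dom C g))"

text \<open>
A list object \<open>L\<close> over \<open>X\<close> admits unique parametrized recursion; when binary coproducts exist, this says
that \<open>L \<otimes> Y\<close> is an initial algebra of the functor \<open>Y + X \<otimes> -\<close> for every \<open>Y\<close>. The parameter is part of the universal property
because without exponentials it cannot be absorbed into the result, and concatenation needs it.
\<close>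
locale list_object = monoidal_category +
  fixes X L nil cons
  assumes X_obj [simp]: "X \<in> Obj C"
    and nil_hom: "nil \<in> hom C \<I> L"
    and cons_hom: "cons \<in> hom C (X \<otimes>\<^sub>o L) L"
    and parametrized_rec_ex1: "\<lbrakk>g \<in> Arr C; a \<in> hom C (X \<otimes>\<^sub>o Cod C g) (Cod C g)\<rbrakk> \<Longrightarrow>
      \<exists>!h. parametrized_rec C X L nil cons g a h"
begin

abbreviation is_rec where "is_rec \<equiv> parametrized_rec C X L nil cons"

lemma nil_typing [simp]: "nil \<in> Arr C" "Dom C nil = \<I>" "Cod C nil = L"
  using nil_hom by simp_all

lemma cons_typing [simp]: "cons \<in> Arr C" "Dom C cons = X \<otimes>\<^sub>o L" "Cod C cons = L"
  using cons_hom by simp_all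

lemma L_obj [simp]: "L \<in> Obj C"
  using cod_obj[of nil] by simp

lemma rec_unique:
  "is_rec g a h \<Longrightarrow> is_rec g a h' \<Longrightarrow> g \<in> Arr C \<Longrightarrow> a \<in> hom C (X \<otimes>\<^sub>o Cod C g) (Cod C g) \<Longrightarrow> h = h'"
  using parametrized_rec_ex1 by metis

text \<open>
Recursion without a parameter is recursion with the parameter \<open>\<I>\<close>, transported along
\<open>runit L\<close>; the two sets of equations correspond by the unit triangles \<open>lunit_unit\<close> and \<open>runit_tensor\<close>.
\<close>
lemma unparametrized_rec_iff:
  assumes Z [simp]: "Z \<in> Obj C" and g [simp]: "g \<in> Arr C" "Dom C g = \<I>" "Cod C g = Z"
    and a [simp]: "a \<in> Arr C" "Dom C a = X \<otimes>\<^sub>o Z" "Cod C a = Z"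
    and h [simp]: "h \<in> Arr C" "Dom C h = L" "Cod C h = Z"
  shows "is_rec g a (h \<cdot> runit C L) \<longleftrightarrow> h \<cdot> nil = g \<and> h \<cdot> cons = a \<cdot> (Ident C X \<otimes> h)"
proof -
  have "(h \<cdot> runit C L) \<cdot> (nil \<otimes> Ident C \<I>) = (h \<cdot> nil) \<cdot> runit C \<I>"
    by (simp add: runit_nat)
  moreover have "(h \<cdot> runit C L) \<cdot> (cons \<otimes> Ident C \<I>) = (h \<cdot> cons) \<cdot> runit C (X \<otimes>\<^sub>o L)"
    by (simp add: runit_nat)
  moreover have "a \<cdot> ((Ident C X \<otimes> (h \<cdot> runit C L)) \<cdot> assoc C X L \<I>) = (a \<cdot> (Ident C X \<otimes> h)) \<cdot> runit C (X \<otimes>\<^sub>o L)"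
    by (simp flip: runit_tensor)
  moreover have "(h \<cdot> nil) \<cdot> runit C \<I> = g \<cdot> runit C \<I> \<longleftrightarrow> h \<cdot> nil = g"
    by (metis (no_types) iso_cancel_right runit_iso unit_obj unitor_typing comp_typing nil_typing h g)
  moreover have "(h \<cdot> cons) \<cdot> runit C (X \<otimes>\<^sub>o L) = (a \<cdot> (Ident C X \<otimes> h)) \<cdot> runit C (X \<otimes>\<^sub>o L)
      \<longleftrightarrow> h \<cdot> cons = a \<cdot> (Ident C X \<otimes> h)"
    using iso_cancel_right[OF runit_iso[of "X \<otimes>\<^sub>o L"], of "h \<cdot> cons" "a \<cdot> (Ident C X \<otimes> h)"]
    by (auto simp del: comp_assoc_typed)
  ultimately show ?thesis
    by (simp add: parametrized_rec_def lunit_unit)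
qed

lemma fold_ex:
  assumes g: "g \<in> hom C \<I> Z" and a: "a \<in> hom C (X \<otimes>\<^sub>o Z) Z"
  shows "\<exists>h \<in> hom C L Z. h \<cdot> nil = g \<and> h \<cdot> cons = a \<cdot> (Ident C X \<otimes> h)"
proof -
  obtain h where h: "is_rec g a h" using parametrized_rec_ex1[of g a] g a by auto
  have Z: "Z \<in> Obj C" using hom_objs(2)[OF g] .
  have ht: "h \<in> Arr C" "Dom C h = L \<otimes>\<^sub>o \<I>" "Cod C h = Z" using h g by (auto simp: parametrized_rec_def)
  let ?h = "h \<cdot> inv_arr (runit C L)"
  have "?h \<cdot> runit C L = h" using ht by simp
  then have "is_rec g a (?h \<cdot> runit C L)" using h by simp
  then show ?thesis
    using ht g a Z by (subst (asm) unparametrized_rec_iff[of Z]) (auto intro!: bexI[of _ ?h])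
qed

lemma fold_unique:
  assumes a: "a \<in> hom C (X \<otimes>\<^sub>o Z) Z"
    and h: "h \<in> hom C L Z" "h \<cdot> cons = a \<cdot> (Ident C X \<otimes> h)"
    and k: "k \<in> hom C L Z" "k \<cdot> cons = a \<cdot> (Ident C X \<otimes> k)"
    and eq: "h \<cdot> nil = k \<cdot> nil"
  shows "h = k"
proof -
  have Z: "Z \<in> Obj C" using hom_objs(2)[OF h(1)] .
  have "is_rec (h \<cdot> nil) a (h \<cdot> runit C L)"
    using unparametrized_rec_iff[of Z "h \<cdot> nil" a h] a h Z by simp
  moreover have "is_rec (h \<cdot> nil) a (k \<cdot> runit C L)"
    using unparametrized_rec_iff[of Z "h \<cdot> nil" a k] a h k eq Z by simp
  ultimately have "h \<cdot> runit C L = k \<cdot> runit C L"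
    by (rule rec_unique) (use a h(1) in simp_all)
  then show ?thesis
    by (rule iso_cancel_right[OF runit_iso[OF L_obj], rotated -1]) (use h(1) k(1) in simp_all)
qed

definition list_mult :: "'b" where
  "list_mult = (THE h. is_rec (Ident C L) cons h)"

lemma list_mult_rec: "is_rec (Ident C L) cons list_mult"
  unfolding list_mult_def by (rule theI') (rule parametrized_rec_ex1; simp)

lemma list_mult_typing [simp]: "list_mult \<in> Arr C" "Dom C list_mult = L \<otimes>\<^sub>o L" "Cod C list_mult = L"
  and list_mult_nil: "list_mult \<cdot> (nil \<otimes> Ident C L) = lunit C L"
  and list_mult_cons: "list_mult \<cdot> (cons \<otimes> Ident C L) = cons \<cdot> ((Ident C X \<otimes> list_mult) \<cdot> assoc C X L L)"
  using list_mult_rec by (simp_all add: parametrized_rec_def)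

text \<open>
Unlike the left unit law, which is a defining equation of concatenation, the right one and
associativity are proved by recursion: both sides solve the same recursion problem.
\<close>
lemma list_mult_nil_right: "list_mult \<cdot> (Ident C L \<otimes> nil) = runit C L"
proof (rule rec_unique)
  show "is_rec nil cons (runit C L)"
    using unparametrized_rec_iff[of L nil cons "Ident C L"] by simp
  have "(list_mult \<cdot> (Ident C L \<otimes> nil)) \<cdot> (nil \<otimes> Ident C \<I>)
      = (list_mult \<cdot> (nil \<otimes> Ident C L)) \<cdot> (Ident C \<I> \<otimes> nil)" by simp
  also have "\<dots> = nil \<cdot> lunit C \<I>"
    unfolding list_mult_nil by (simp add: lunit_nat)
  finally have *: "(list_mult \<cdot> (Ident C L \<otimes> nil)) \<cdot> (nil \<otimes> Ident C \<I>) = nil \<cdot> lunit C \<I>" .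
  have "(list_mult \<cdot> (Ident C L \<otimes> nil)) \<cdot> (cons \<otimes> Ident C \<I>)
      = (list_mult \<cdot> (cons \<otimes> Ident C L)) \<cdot> ((Ident C X \<otimes> Ident C L) \<otimes> nil)" by simp
  also have "\<dots> = cons \<cdot> ((Ident C X \<otimes> list_mult) \<cdot> (assoc C X L L \<cdot> ((Ident C X \<otimes> Ident C L) \<otimes> nil)))"
    unfolding list_mult_cons by simp
  also have "\<dots> = cons \<cdot> ((Ident C X \<otimes> (list_mult \<cdot> (Ident C L \<otimes> nil))) \<cdot> assoc C X L \<I>)"
    by (subst assoc_nat) simp_all
  finally show "is_rec nil cons (list_mult \<cdot> (Ident C L \<otimes> nil))"
    using * by (simp add: parametrized_rec_def)
qed simp_all

text \<open>
After moving the associator to the other side, both sides are arrows on \<open>L \<otimes> (L \<otimes> L)\<close> that satisfy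
the recursion with parameter object \<open>L \<otimes> L\<close> starting from the multiplication. The pentagon, in the form of the fact \<open>pent\<close>, carries the
inv_arr associator past \<open>cons\<close>.
\<close>
lemma list_mult_assoc:
  "list_mult \<cdot> (list_mult \<otimes> Ident C L) = list_mult \<cdot> ((Ident C L \<otimes> list_mult) \<cdot> assoc C L L L)"
proof -
  let ?I = "Ident C L"
  let ?k = "list_mult \<cdot> ((list_mult \<otimes> ?I) \<cdot> inv_arr (assoc C L L L))"
  have inv_nil: "inv_arr (assoc C L L L) \<cdot> (nil \<otimes> Ident C (L \<otimes>\<^sub>o L))
      = ((nil \<otimes> ?I) \<otimes> ?I) \<cdot> inv_arr (assoc C \<I> L L)"
  proof (rule iso_cancel_left[OF assoc_iso[of L L L]])
    show "assoc C L L L \<cdot> (inv_arr (assoc C L L L) \<cdot> (nil \<otimes> Ident C (L \<otimes>\<^sub>o L)))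
        = assoc C L L L \<cdot> (((nil \<otimes> ?I) \<otimes> ?I) \<cdot> inv_arr (assoc C \<I> L L))"
      by (subst comp_eq_extend, rule inverse_assoc; simp add: assoc_nat_chain)
  qed simp_all
  have inv_cons: "inv_arr (assoc C L L L) \<cdot> (cons \<otimes> Ident C (L \<otimes>\<^sub>o L))
      = ((cons \<otimes> ?I) \<otimes> ?I) \<cdot> inv_arr (assoc C (X \<otimes>\<^sub>o L) L L)"
  proof (rule iso_cancel_left[OF assoc_iso[of L L L]])
    show "assoc C L L L \<cdot> (inv_arr (assoc C L L L) \<cdot> (cons \<otimes> Ident C (L \<otimes>\<^sub>o L)))
        = assoc C L L L \<cdot> (((cons \<otimes> ?I) \<otimes> ?I) \<cdot> inv_arr (assoc C (X \<otimes>\<^sub>o L) L L))"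
      by (subst comp_eq_extend, rule inverse_assoc; simp add: assoc_nat_chain)
  qed simp_all
  have "list_mult \<cdot> (?I \<otimes> list_mult) = ?k"
  proof (rule rec_unique)
    have "(list_mult \<cdot> (?I \<otimes> list_mult)) \<cdot> (nil \<otimes> Ident C (L \<otimes>\<^sub>o L))
        = (list_mult \<cdot> (nil \<otimes> ?I)) \<cdot> (Ident C \<I> \<otimes> list_mult)" by simp
    also have "\<dots> = list_mult \<cdot> lunit C (L \<otimes>\<^sub>o L)"
      unfolding list_mult_nil by (simp add: lunit_nat)
    finally have 1: "(list_mult \<cdot> (?I \<otimes> list_mult)) \<cdot> (nil \<otimes> Ident C (L \<otimes>\<^sub>o L)) = list_mult \<cdot> lunit C (L \<otimes>\<^sub>o L)" .
    have "(list_mult \<cdot> (?I \<otimes> list_mult)) \<cdot> (cons \<otimes> Ident C (L \<otimes>\<^sub>o L))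
        = (list_mult \<cdot> (cons \<otimes> ?I)) \<cdot> ((Ident C X \<otimes> ?I) \<otimes> list_mult)" by simp
    also have "\<dots> = cons \<cdot> ((Ident C X \<otimes> list_mult) \<cdot> (assoc C X L L \<cdot> ((Ident C X \<otimes> ?I) \<otimes> list_mult)))"
      unfolding list_mult_cons by simp
    also have "\<dots> = cons \<cdot> ((Ident C X \<otimes> (list_mult \<cdot> (?I \<otimes> list_mult))) \<cdot> assoc C X L (L \<otimes>\<^sub>o L))"
      by (subst assoc_nat) simp_all
    finally show "is_rec list_mult cons (list_mult \<cdot> (?I \<otimes> list_mult))"
      using 1 by (simp add: parametrized_rec_def)
  next
    have "?k \<cdot> (nil \<otimes> Ident C (L \<otimes>\<^sub>o L))
        = list_mult \<cdot> ((list_mult \<otimes> ?I) \<cdot> (((nil \<otimes> ?I) \<otimes> ?I) \<cdot> inv_arr (assoc C \<I> L L)))"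
      by (simp add: inv_nil)
    also have "\<dots> = list_mult \<cdot> ((lunit C L \<otimes> ?I) \<cdot> inv_arr (assoc C \<I> L L))"
      by (simp add: list_mult_nil)
    also have "\<dots> = list_mult \<cdot> lunit C (L \<otimes>\<^sub>o L)"
      by (simp flip: lunit_tensor)
    finally have 1: "?k \<cdot> (nil \<otimes> Ident C (L \<otimes>\<^sub>o L)) = list_mult \<cdot> lunit C (L \<otimes>\<^sub>o L)" .
    let ?b = "inv_arr (assoc C (X \<otimes>\<^sub>o L) L L)"
    have pent: "(assoc C X (L \<otimes>\<^sub>o L) L) \<cdot> ((assoc C X L L \<otimes> ?I) \<cdot> ?b)
        = (Ident C X \<otimes> inv_arr (assoc C L L L)) \<cdot> assoc C X L (L \<otimes>\<^sub>o L)"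
    proof -
      have "(Ident C X \<otimes> inv_arr (assoc C L L L)) \<cdot> (assoc C X L (L \<otimes>\<^sub>o L) \<cdot> (assoc C (X \<otimes>\<^sub>o L) L L \<cdot> ?b))
        = (Ident C X \<otimes> inv_arr (assoc C L L L)) \<cdot> ((assoc C X L (L \<otimes>\<^sub>o L) \<cdot> assoc C (X \<otimes>\<^sub>o L) L L) \<cdot> ?b)"
        by (simp del: inverse_assoc(5))
      also have "\<dots> = (Ident C X \<otimes> (inv_arr (assoc C L L L) \<cdot> assoc C L L L)) \<cdot>
          (assoc C X (L \<otimes>\<^sub>o L) L \<cdot> ((assoc C X L L \<otimes> ?I) \<cdot> ?b))"
        by (subst pentagon) (simp_all del: inverse_assoc(4))
      finally show ?thesis by simp
    qed
    have "?k \<cdot> (cons \<otimes> Ident C (L \<otimes>\<^sub>o L)) = list_mult \<cdot> (((list_mult \<cdot> (cons \<otimes> ?I)) \<otimes> ?I) \<cdot> ?b)"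
      by (simp add: inv_cons)
    also have "\<dots> = list_mult \<cdot> (((cons \<cdot> ((Ident C X \<otimes> list_mult) \<cdot> assoc C X L L)) \<otimes> ?I) \<cdot> ?b)"
      by (simp only: list_mult_cons)
    also have "\<dots> = (list_mult \<cdot> (cons \<otimes> ?I)) \<cdot> (((Ident C X \<otimes> list_mult) \<otimes> ?I) \<cdot> ((assoc C X L L \<otimes> ?I) \<cdot> ?b))"
      by simp
    also have "\<dots> = cons \<cdot> ((Ident C X \<otimes> list_mult) \<cdot> (assoc C X L L \<cdot>
        (((Ident C X \<otimes> list_mult) \<otimes> ?I) \<cdot> ((assoc C X L L \<otimes> ?I) \<cdot> ?b))))"
      unfolding list_mult_cons by simp
    also have "\<dots> = cons \<cdot> ((Ident C X \<otimes> list_mult) \<cdot> ((Ident C X \<otimes> (list_mult \<otimes> ?I)) \<cdot>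
        (assoc C X (L \<otimes>\<^sub>o L) L \<cdot> ((assoc C X L L \<otimes> ?I) \<cdot> ?b))))"
      by (subst assoc_nat_chain) simp_all
    also have "\<dots> = cons \<cdot> ((Ident C X \<otimes> ?k) \<cdot> assoc C X L (L \<otimes>\<^sub>o L))"
      unfolding pent by simp
    finally show "is_rec list_mult cons ?k"
      using 1 by (simp add: parametrized_rec_def)
  qed simp_all
  then have "(list_mult \<cdot> (?I \<otimes> list_mult)) \<cdot> assoc C L L L = ?k \<cdot> assoc C L L L" by simp
  then show ?thesis by simp
qed

abbreviation list_monoid where "list_monoid \<equiv> (L, list_mult, nil)"

lemma list_monoid: "is_monoid C list_monoid"
  by (rule monoidI) (simp_all add: list_mult_nil list_mult_nil_right list_mult_assoc)

definition singleton :: "'b" where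
  "singleton = cons \<cdot> ((Ident C X \<otimes> nil) \<cdot> inv_arr (runit C X))"

lemma singleton_typing [simp]: "singleton \<in> Arr C" "Dom C singleton = X" "Cod C singleton = L"
  by (simp_all add: singleton_def)

lemma list_mult_singleton: "list_mult \<cdot> (singleton \<otimes> Ident C L) = cons"
proof -
  let ?I = "Ident C L"
  let ?r = "inv_arr (runit C X) \<otimes> ?I"
  have "list_mult \<cdot> (singleton \<otimes> ?I) = (list_mult \<cdot> (cons \<otimes> ?I)) \<cdot> (((Ident C X \<otimes> nil) \<otimes> ?I) \<cdot> ?r)"
    by (simp add: singleton_def)
  also have "\<dots> = cons \<cdot> ((Ident C X \<otimes> list_mult) \<cdot> (assoc C X L L \<cdot> (((Ident C X \<otimes> nil) \<otimes> ?I) \<cdot> ?r)))"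
    unfolding list_mult_cons by simp
  also have "\<dots> = cons \<cdot> ((Ident C X \<otimes> (list_mult \<cdot> (nil \<otimes> ?I))) \<cdot> (assoc C X \<I> L \<cdot> ?r))"
    by (subst assoc_nat_chain) simp_all
  also have "\<dots> = cons \<cdot> (((Ident C X \<otimes> lunit C L) \<cdot> assoc C X \<I> L) \<cdot> ?r)"
    by (simp add: list_mult_nil)
  also have "\<dots> = cons"
    by (subst triangle) simp_all
  finally show ?thesis .
qed

text \<open>
The extension of \<open>f\<close> multiplies the values of \<open>f\<close> along a list: \<open>h nil = 1\<close> and
\<open>h (cons x xs) = f x * h xs\<close>. It is multiplicative because \<open>h (xs @ ys)\<close> and \<open>h xs * h ys\<close>
satisfy the same recursion in \<open>xs\<close> with parameter \<open>ys\<close>.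
\<close>
lemma monoid_extension:
  assumes N: "is_monoid C (N, n, v)" and f: "f \<in> Arr C" "Dom C f = X" "Cod C f = N"
  shows "\<exists>h. monoid_hom C list_monoid (N, n, v) h \<and> h \<cdot> singleton = f"
proof -
  note [simp] = monoidD(1-7)[OF N] f
  let ?I = "Ident C N" and ?a = "n \<cdot> (f \<otimes> Ident C N)"
  obtain h where h [simp]: "h \<in> Arr C" "Dom C h = L" "Cod C h = N"
    and h_nil: "h \<cdot> nil = v" and "h \<cdot> cons = ?a \<cdot> (Ident C X \<otimes> h)"
    using fold_ex[of v N ?a] by auto
  then have h_cons: "h \<cdot> cons = n \<cdot> (f \<otimes> h)" by simp
  have "h \<cdot> list_mult = n \<cdot> (h \<otimes> h)"
  proof (rule rec_unique[of h ?a])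
    have "(h \<cdot> list_mult) \<cdot> (nil \<otimes> Ident C L) = h \<cdot> lunit C L" by (simp add: list_mult_nil)
    moreover have "(h \<cdot> list_mult) \<cdot> (cons \<otimes> Ident C L)
        = (h \<cdot> cons) \<cdot> ((Ident C X \<otimes> list_mult) \<cdot> assoc C X L L)" by (simp add: list_mult_cons)
    moreover have "\<dots> = ?a \<cdot> ((Ident C X \<otimes> (h \<cdot> list_mult)) \<cdot> assoc C X L L)"
      unfolding h_cons by simp
    ultimately show "is_rec h ?a (h \<cdot> list_mult)" by (simp add: parametrized_rec_def)
    have "(n \<cdot> (h \<otimes> h)) \<cdot> (nil \<otimes> Ident C L) = (n \<cdot> (v \<otimes> ?I)) \<cdot> (Ident C \<I> \<otimes> h)" by (simp add: h_nil)
    also have "\<dots> = h \<cdot> lunit C L" unfolding monoidD(9)[OF N] by (simp add: lunit_nat)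
    finally have 1: "(n \<cdot> (h \<otimes> h)) \<cdot> (nil \<otimes> Ident C L) = h \<cdot> lunit C L" .
    have "(n \<cdot> (h \<otimes> h)) \<cdot> (cons \<otimes> Ident C L) = (n \<cdot> (n \<otimes> ?I)) \<cdot> ((f \<otimes> h) \<otimes> h)" by (simp add: h_cons)
    also have "\<dots> = n \<cdot> ((?I \<otimes> n) \<cdot> (assoc C N N N \<cdot> ((f \<otimes> h) \<otimes> h)))"
      unfolding monoidD(8)[OF N] by simp
    also have "\<dots> = ?a \<cdot> ((Ident C X \<otimes> (n \<cdot> (h \<otimes> h))) \<cdot> assoc C X L L)"
      by (subst assoc_nat) simp_all
    finally show "is_rec h ?a (n \<cdot> (h \<otimes> h))" using 1 by (simp add: parametrized_rec_def)
  qed simp_all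
  moreover have "h \<cdot> singleton = f"
  proof -
    have "h \<cdot> singleton = (h \<cdot> cons) \<cdot> ((Ident C X \<otimes> nil) \<cdot> inv_arr (runit C X))" by (simp add: singleton_def)
    also have "\<dots> = (n \<cdot> (?I \<otimes> v)) \<cdot> ((f \<otimes> Ident C \<I>) \<cdot> inv_arr (runit C X))"
      unfolding h_cons by (simp add: h_nil)
    also have "\<dots> = (runit C N \<cdot> (f \<otimes> Ident C \<I>)) \<cdot> inv_arr (runit C X)" unfolding monoidD(10)[OF N] by simp
    also have "\<dots> = f" by (subst runit_nat) simp_all
    finally show ?thesis .
  qed
  ultimately show ?thesis by (intro exI[of _ h]) (simp add: monoid_hom_iff h_nil)
qed

text \<open>
As \<open>cons\<close> is multiplication by a singleton, a monoid morphism is determined as a fold by its values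
on singletons.
\<close>
lemma monoid_extension_unique:
  assumes N: "is_monoid C (N, n, v)"
    and h: "monoid_hom C list_monoid (N, n, v) h" and k: "monoid_hom C list_monoid (N, n, v) k"
    and eq: "h \<cdot> singleton = k \<cdot> singleton"
  shows "h = k"
proof -
  note [simp] = monoidD(1-7)[OF N]
  let ?a = "n \<cdot> ((h \<cdot> singleton) \<otimes> Ident C N)"
  have fold: "j \<cdot> cons = (n \<cdot> ((j \<cdot> singleton) \<otimes> Ident C N)) \<cdot> (Ident C X \<otimes> j)"
    if j: "monoid_hom C list_monoid (N, n, v) j" for j
  proof -
    have t [simp]: "j \<in> Arr C" "Dom C j = L" "Cod C j = N" and jm: "j \<cdot> list_mult = n \<cdot> (j \<otimes> j)"
      using j by (simp_all add: monoid_hom_iff)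
    have "j \<cdot> cons = (j \<cdot> list_mult) \<cdot> (singleton \<otimes> Ident C L)" by (simp add: list_mult_singleton)
    then show ?thesis unfolding jm by simp
  qed
  show ?thesis
  proof (rule fold_unique[of ?a N])
    show "h \<cdot> cons = ?a \<cdot> (Ident C X \<otimes> h)" by (rule fold[OF h])
    show "k \<cdot> cons = ?a \<cdot> (Ident C X \<otimes> k)" unfolding eq by (rule fold[OF k])
  qed (use h k in \<open>simp_all add: monoid_hom_iff\<close>)
qed

end

section \<open>List objects from countable coproducts\<close>

lemma coproductD:
  assumes "is_coproduct C I X Q k" "R \<in> Obj C" "\<And>i. i \<in> I \<Longrightarrow> l i \<in> hom C (X i) R"
  shows "\<exists>h \<in> hom C Q R. \<forall>i \<in> I. h \<cdot>\<^bsub>C\<^esub> k i = l i"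
  using assms unfolding is_coproduct_def by blast

lemma coproduct_unique:
  assumes cop: "is_coproduct C I X Q k" and C: "category C"
    and h: "h \<in> hom C Q R" and h': "h' \<in> hom C Q R"
    and eq: "\<And>i. i \<in> I \<Longrightarrow> h \<cdot>\<^bsub>C\<^esub> k i = h' \<cdot>\<^bsub>C\<^esub> k i"
  shows "h = h'"
proof -
  interpret category C by (rule C)
  have R: "R \<in> Obj C" by (rule hom_objs[OF h])
  have *: "\<forall>i\<in>I. h \<cdot>\<^bsub>C\<^esub> k i \<in> hom C (X i) R"
    using cop h unfolding is_coproduct_def by auto
  have "\<exists>!j. j \<in> hom C Q R \<and> (\<forall>i \<in> I. j \<cdot>\<^bsub>C\<^esub> k i = h \<cdot>\<^bsub>C\<^esub> k i)"
    by (rule cop[unfolded is_coproduct_def, THEN conjunct2, THEN conjunct2, THEN bspec, OF R,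
        THEN spec, THEN mp, OF *])
  then show ?thesis using h h' eq by metis
qed

context monoidal_category
begin

primrec tensor_power :: "'o \<Rightarrow> nat \<Rightarrow> 'o" where
  "tensor_power X 0 = \<I>"
| "tensor_power X (Suc n) = X \<otimes>\<^sub>o tensor_power X n"

lemma tensor_power_obj [simp]: "X \<in> Obj C \<Longrightarrow> tensor_power X n \<in> Obj C"
  by (induction n) simp_all

lemma coproduct_tensor:
  assumes "tensor_preserves_countable_coproducts C" "is_coproduct C (I :: nat set) P Q k" "A \<in> Obj C"
  shows "is_coproduct C I (\<lambda>i. A \<otimes>\<^sub>o P i) (A \<otimes>\<^sub>o Q) (\<lambda>i. Ident C A \<otimes> k i)"
    "is_coproduct C I (\<lambda>i. P i \<otimes>\<^sub>o A) (Q \<otimes>\<^sub>o A) (\<lambda>i. k i \<otimes> Ident C A)"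
  using assms
  by (fastforce simp: tensor_preserves_countable_coproducts_def preserves_countable_coproducts_def
      tensor_left_def tensor_right_def)+

text \<open>
The list object is the coproduct of the tensor powers of \<open>X\<close>. Because \<open>- \<otimes> Y\<close> preserves it, an
arrow on \<open>L \<otimes> Y\<close> is a sequence of arrows on \<open>tensor_power X n \<otimes> Y\<close>, and the recursion equations
say precisely that the sequence is the one defined by primitive recursion on \<open>n\<close>.
\<close>
lemma list_object_exists:
  assumes cop: "has_countable_coproducts C" and pres: "tensor_preserves_countable_coproducts C"
    and X [simp]: "X \<in> Obj C"
  shows "\<exists>L nil cons. list_object C X L nil cons"
proof -
  let ?P = "tensor_power X"
  obtain L k where L: "is_coproduct C UNIV ?P L k"
    using cop unfolding has_countable_coproducts_def by (metis X tensor_power_obj)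
  have L_obj [simp]: "L \<in> Obj C" and k [simp]: "k n \<in> Arr C" "Dom C (k n) = ?P n" "Cod C (k n) = L" for n
    using L by (auto simp: is_coproduct_def)
  note XL = coproduct_tensor(1)[OF pres L X]
  obtain cons where cons [simp]: "cons \<in> Arr C" "Dom C cons = X \<otimes>\<^sub>o L" "Cod C cons = L"
    and cons_k: "\<And>n. cons \<cdot> (Ident C X \<otimes> k n) = k (Suc n)"
    using coproductD[OF XL, of L "\<lambda>n. k (Suc n)"] by auto
  have "list_object C X L (k 0) cons"
  proof (unfold_locales)
    fix g a assume g [simp]: "g \<in> Arr C" and a: "a \<in> hom C (X \<otimes>\<^sub>o Cod C g) (Cod C g)"
    define Y where "Y = Dom C g"
    define Z where "Z = Cod C g"
    have Y [simp]: "Y \<in> Obj C" "Z \<in> Obj C" by (simp_all add: Y_def Z_def)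
    have gt [simp]: "Dom C g = Y" "Cod C g = Z" by (simp_all add: Y_def Z_def)
    have a [simp]: "a \<in> Arr C" "Dom C a = X \<otimes>\<^sub>o Z" "Cod C a = Z" using a by simp_all
    note LY = coproduct_tensor(2)[OF pres L Y(1)]
    note XLY = coproduct_tensor(2)[OF pres XL Y(1)]
    \<comment> \<open>The value of the recursion on lists of length \<open>n\<close>.\<close>
    define l where "l = rec_nat (g \<cdot> lunit C Y) (\<lambda>n h. a \<cdot> ((Ident C X \<otimes> h) \<cdot> assoc C X (?P n) Y))"
    have l_simps: "l 0 = g \<cdot> lunit C Y" "\<And>n. l (Suc n) = a \<cdot> ((Ident C X \<otimes> l n) \<cdot> assoc C X (?P n) Y)"
      by (simp_all add: l_def)
    have l [simp]: "l n \<in> Arr C" "Dom C (l n) = ?P n \<otimes>\<^sub>o Y" "Cod C (l n) = Z" for n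
      by (induction n) (simp_all add: l_simps)
    have step: "(a \<cdot> ((Ident C X \<otimes> h) \<cdot> assoc C X L Y)) \<cdot> ((Ident C X \<otimes> k n) \<otimes> Ident C Y)
        = a \<cdot> ((Ident C X \<otimes> (h \<cdot> (k n \<otimes> Ident C Y))) \<cdot> assoc C X (?P n) Y)"
      if "h \<in> Arr C" "Dom C h = L \<otimes>\<^sub>o Y" "Cod C h = Z" for h n
      using that by (simp add: assoc_nat)
    have iff: "parametrized_rec C X L (k 0) cons g a h \<longleftrightarrow>
        h \<in> hom C (L \<otimes>\<^sub>o Y) Z \<and> (\<forall>n. h \<cdot> (k n \<otimes> Ident C Y) = l n)" for h
    proof (cases "h \<in> hom C (L \<otimes>\<^sub>o Y) Z")
      case True
      then have h [simp]: "h \<in> Arr C" "Dom C h = L \<otimes>\<^sub>o Y" "Cod C h = Z" by simp_all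
      have k_Suc: "h \<cdot> (k (Suc n) \<otimes> Ident C Y) = (h \<cdot> (cons \<otimes> Ident C Y)) \<cdot> ((Ident C X \<otimes> k n) \<otimes> Ident C Y)" for n
        by (simp add: cons_k)
      let ?r = "a \<cdot> ((Ident C X \<otimes> h) \<cdot> assoc C X L Y)"
      \<comment> \<open>The arrows \<open>(X \<otimes> k n) \<otimes> Y\<close> form a coproduct, so the equation for \<open>cons\<close> can be tested on each
        of them.\<close>
      have "h \<cdot> (cons \<otimes> Ident C Y) = ?r \<longleftrightarrow>
          (\<forall>n. h \<cdot> (k (Suc n) \<otimes> Ident C Y) = ?r \<cdot> ((Ident C X \<otimes> k n) \<otimes> Ident C Y))"
      proof
        assume *: "\<forall>n. h \<cdot> (k (Suc n) \<otimes> Ident C Y) = ?r \<cdot> ((Ident C X \<otimes> k n) \<otimes> Ident C Y)"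
        show "h \<cdot> (cons \<otimes> Ident C Y) = ?r"
        proof (rule coproduct_unique[OF XLY category_axioms])
          show "h \<cdot> (cons \<otimes> Ident C Y) \<cdot> ((Ident C X \<otimes> k n) \<otimes> Ident C Y) = ?r \<cdot> ((Ident C X \<otimes> k n) \<otimes> Ident C Y)" for n
            using * k_Suc by metis
        qed simp_all
      next
        assume "h \<cdot> (cons \<otimes> Ident C Y) = ?r"
        then show "\<forall>n. h \<cdot> (k (Suc n) \<otimes> Ident C Y) = ?r \<cdot> ((Ident C X \<otimes> k n) \<otimes> Ident C Y)"
          unfolding k_Suc by metis
      qed
      then have "parametrized_rec C X L (k 0) cons g a h \<longleftrightarrow> h \<cdot> (k 0 \<otimes> Ident C Y) = l 0 \<and>
          (\<forall>n. h \<cdot> (k (Suc n) \<otimes> Ident C Y) = a \<cdot> ((Ident C X \<otimes> (h \<cdot> (k n \<otimes> Ident C Y))) \<cdot> assoc C X (?P n) Y))"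
        unfolding step[OF h] by (simp add: parametrized_rec_def l_simps)
      also have "\<dots> \<longleftrightarrow> (\<forall>n. h \<cdot> (k n \<otimes> Ident C Y) = l n)"
      proof safe
        fix n assume 0: "h \<cdot> (k 0 \<otimes> Ident C Y) = l 0"
          and S: "\<forall>n. h \<cdot> (k (Suc n) \<otimes> Ident C Y) = a \<cdot> ((Ident C X \<otimes> (h \<cdot> (k n \<otimes> Ident C Y))) \<cdot> assoc C X (?P n) Y)"
        show "h \<cdot> (k n \<otimes> Ident C Y) = l n"
          by (induction n) (simp_all only: 0 S[rule_format] l_simps(2))
      qed (simp_all only: l_simps(2))
      finally show ?thesis using True by simp
    qed (auto simp: parametrized_rec_def)
    obtain h where "h \<in> hom C (L \<otimes>\<^sub>o Y) Z" "\<forall>n. h \<cdot> (k n \<otimes> Ident C Y) = l n"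
      using coproductD[OF LY, of Z l] by auto
    then show "\<exists>!h. parametrized_rec C X L (k 0) cons g a h"
      unfolding iff
      by (intro ex1I[of _ h] conjI) (auto intro: coproduct_unique[OF LY category_axioms])
  qed simp_all
  then show ?thesis by blast
qed

lemma free_monoid_exists:
  assumes "has_countable_coproducts C" "tensor_preserves_countable_coproducts C" "X \<in> Obj C"
  obtains F \<eta> where "is_monoid C F" "\<eta> \<in> hom C X (fst F)"
    "\<And>N f. is_monoid C N \<Longrightarrow> f \<in> hom C X (fst N) \<Longrightarrow> \<exists>h. monoid_hom C F N h \<and> h \<cdot> \<eta> = f"
    "\<And>N h k. is_monoid C N \<Longrightarrow> monoid_hom C F N h \<Longrightarrow> monoid_hom C F N k \<Longrightarrow> h \<cdot> \<eta> = k \<cdot> \<eta> \<Longrightarrow> h = k"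
proof -
  obtain L nil cons where "list_object C X L nil cons" using list_object_exists[OF assms] by blast
  then interpret list_object C X L nil cons .
  show thesis
  proof (rule that[OF list_monoid, of singleton])
    show "\<exists>h. monoid_hom C list_monoid N h \<and> h \<cdot> singleton = f" if "is_monoid C N" "f \<in> hom C X (fst N)" for N f
      using that monoid_extension by (cases N) auto
    show "h = k" if "is_monoid C N" "monoid_hom C list_monoid N h" "monoid_hom C list_monoid N k"
        "h \<cdot> singleton = k \<cdot> singleton" for N h k
      using that monoid_extension_unique by (cases N) auto
  qed simp
qed

end

section \<open>Colimits of monoids\<close>

definition underlying ::
  "('i, 'j, ('o, 'a) mon, ('o, 'a) mon \<times> 'a \<times> ('o, 'a) mon) cat_functor \<Rightarrow> ('i, 'j, 'o, 'a) cat_functor" where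
  "underlying D = \<lparr>FObj = fst \<circ> FObj D, FArr = fst \<circ> snd \<circ> FArr D\<rparr>"

context monoidal_category
begin

lemma Mon_Obj [simp]: "M \<in> Obj (Mon C) \<longleftrightarrow> is_monoid C M"
  by (simp add: Mon_def)

lemma Mon_hom: "F \<in> hom (Mon C) M N \<longleftrightarrow>
    is_monoid C M \<and> is_monoid C N \<and> (\<exists>f. F = (M, f, N) \<and> monoid_hom C M N f)"
  by (auto simp: Mon_def hom_def)

lemma Mon_Arr [simp]: "(M, f, N) \<in> Arr (Mon C) \<longleftrightarrow> is_monoid C M \<and> is_monoid C N \<and> monoid_hom C M N f"
  and Mon_Dom [simp]: "Dom (Mon C) (M, f, N) = M"
  and Mon_Cod [simp]: "Cod (Mon C) (M, f, N) = N"
  and Mon_Comp [simp]: "Comp (Mon C) (N', g, P) (M, f, N) = (M, g \<cdot> f, P)"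
  and Mon_Ident [simp]: "Ident (Mon C) M = (M, Ident C (fst M), M)"
  by (simp_all add: Mon_def)

lemma underlying_functor:
  assumes D: "is_functor J (Mon C) D"
  shows "is_functor J C (underlying D)"
proof -
  note * = D[unfolded is_functor_def]
  have arr: "\<exists>f. FArr D u = (FObj D (Dom J u), f, FObj D (Cod J u)) \<and>
      monoid_hom C (FObj D (Dom J u)) (FObj D (Cod J u)) f" if "u \<in> Arr J" for u
    using * that unfolding Mon_hom by blast
  have "FObj (underlying D) j \<in> Obj C \<and> FArr (underlying D) (Ident J j) = Ident C (FObj (underlying D) j)"
    if "j \<in> Obj J" for j
    using * that monoid_typing(1) by (simp add: underlying_def)
  moreover have "FArr (underlying D) u \<in> hom C (FObj (underlying D) (Dom J u)) (FObj (underlying D) (Cod J u))"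
    if "u \<in> Arr J" for u
    using arr[OF that] by (auto simp: underlying_def dest: monoid_hom_typing)
  moreover have "FArr (underlying D) (v \<cdot>\<^bsub>J\<^esub> u) = FArr (underlying D) v \<cdot> FArr (underlying D) u"
    if uv: "u \<in> Arr J" "v \<in> Arr J" "Dom J v = Cod J u" for u v
  proof -
    have "FArr D (v \<cdot>\<^bsub>J\<^esub> u) = FArr D v \<cdot>\<^bsub>Mon C\<^esub> FArr D u" using * uv by blast
    then show ?thesis using arr[OF uv(1)] arr[OF uv(2)] by (auto simp: underlying_def)
  qed
  ultimately show ?thesis unfolding is_functor_def by blast
qed

end

context regular_monoidal_category
begin

text \<open>
The coequalizer of \<open>f\<close> and \<open>g\<close> is the image of their codomain under the family of all monoid
morphisms that equalize them.
\<close>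
lemma Mon_has_coequalizers: "has_coequalizers (Mon C)"
  unfolding has_coequalizers_def
proof (intro ballI)
  fix F G assume FG: "F \<in> Arr (Mon C)" "G \<in> hom (Mon C) (Dom (Mon C) F) (Cod (Mon C) F)"
  obtain M f N where F: "F = (M, f, N)" by (metis prod_cases3)
  with FG obtain g where G: "G = (M, g, N)" and M: "is_monoid C M" and N: "is_monoid C N"
    and f: "monoid_hom C M N f" and g: "monoid_hom C M N g"
    by (auto simp: Mon_hom)
  note [simp] = monoid_hom_typing[OF f] monoid_hom_typing[OF g]
  define S where "S = {(h, P). is_monoid C P \<and> monoid_hom C N P h \<and> h \<cdot> f = h \<cdot> g}"
  obtain E e where E: "is_monoid C E" and e: "monoid_hom C N E e" "epi e"
    and fact: "\<And>h P. (h, P) \<in> S \<Longrightarrow> \<exists>k. monoid_hom C E P k \<and> k \<cdot> e = h"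
    and joint: "\<And>r s. r \<in> Arr C \<Longrightarrow> s \<in> Arr C \<Longrightarrow> Dom C r = Dom C s \<Longrightarrow> Cod C r = fst E \<Longrightarrow> Cod C s = fst E \<Longrightarrow>
       (\<And>h P k. (h, P) \<in> S \<Longrightarrow> monoid_hom C E P k \<Longrightarrow> k \<cdot> e = h \<Longrightarrow> k \<cdot> r = k \<cdot> s) \<Longrightarrow> r = s"
    using monoid_image[OF N, of S] unfolding S_def by (smt (verit) case_prodD mem_Collect_eq)
  note [simp] = monoid_hom_typing[OF e(1)]
  have ef: "e \<cdot> f = e \<cdot> g"
  proof (rule joint)
    fix h P k assume hP: "(h, P) \<in> S" and k: "monoid_hom C E P k" "k \<cdot> e = h"
    note [simp] = monoid_hom_typing[OF k(1)]
    have "h \<cdot> f = h \<cdot> g" using hP by (simp add: S_def)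
    then show "k \<cdot> (e \<cdot> f) = k \<cdot> (e \<cdot> g)" unfolding k(2)[symmetric] by simp
  qed simp_all
  have "is_coequalizer (Mon C) F G (N, e, E)"
    unfolding is_coequalizer_def
  proof (intro conjI ballI impI)
    fix H assume H: "H \<in> Arr (Mon C)" "Dom (Mon C) H = Cod (Mon C) F \<and> H \<cdot>\<^bsub>Mon C\<^esub> F = H \<cdot>\<^bsub>Mon C\<^esub> G"
    then obtain h P where H_def: "H = (N, h, P)" and P: "is_monoid C P" and h: "monoid_hom C N P h"
      and "h \<cdot> f = h \<cdot> g"
      by (cases H) (auto simp: F G)
    then have "(h, P) \<in> S" by (simp add: S_def)
    from fact[OF this] obtain k where k: "monoid_hom C E P k" "k \<cdot> e = h" by blast
    show "\<exists>!K. K \<in> hom (Mon C) (Cod (Mon C) (N, e, E)) (Cod (Mon C) H) \<and> K \<cdot>\<^bsub>Mon C\<^esub> (N, e, E) = H"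
    proof (rule ex1I[of _ "(E, k, P)"])
      fix K assume "K \<in> hom (Mon C) (Cod (Mon C) (N, e, E)) (Cod (Mon C) H) \<and> K \<cdot>\<^bsub>Mon C\<^esub> (N, e, E) = H"
      then obtain k' where K: "K = (E, k', P)" and k': "monoid_hom C E P k'" "k' \<cdot> e = h"
        by (auto simp: H_def Mon_hom)
      have "k' = k"
        by (rule epiD[OF e(2)]) (use k k' monoid_hom_typing[OF k(1)] monoid_hom_typing[OF k'(1)] in simp_all)
      then show "K = (E, k, P)" by (simp add: K)
    qed (use k E P in \<open>simp add: H_def Mon_hom\<close>)
  qed (use FG E N e ef in \<open>simp_all add: F G\<close>)
  then show "\<exists>q. is_coequalizer (Mon C) F G q" by blast
qed

text \<open>
Let \<open>L\<close> be the colimit in \<open>C\<close> of the underlying objects, with injections \<open>c\<close>, and \<open>F\<close> the free monoid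
on \<open>L\<close>. The arrows \<open>\<eta> \<cdot> c j\<close> into \<open>F\<close> need not be monoid morphisms. Take the image \<open>E\<close> of \<open>F\<close> under all
monoid morphisms \<open>h\<close> for which every \<open>h \<cdot> (\<eta> \<cdot> c j)\<close> is one. Joint monicity makes the
composites into \<open>E\<close> monoid morphisms, and each cocone of monoids extends to \<open>F\<close> and belongs to
the family, hence factors through \<open>E\<close>.
\<close>
lemma Mon_has_colimits:
  assumes cop: "has_countable_coproducts C" "tensor_preserves_countable_coproducts C"
    and J: "category J" and colim: "has_colimits_of_shape J C"
  shows "has_colimits_of_shape J (Mon C)"
  unfolding has_colimits_of_shape_def
proof (intro allI impI)
  fix D assume D: "is_functor J (Mon C) D"
  let ?U = "underlying D"
  have D_mon: "is_monoid C (FObj D j)" if "j \<in> Obj J" for j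
    using D that by (simp add: is_functor_def)
  obtain L c where L: "is_colimit J C ?U L c"
    using colim underlying_functor[OF D] unfolding has_colimits_of_shape_def by blast
  have L_obj: "L \<in> Obj C" and c [simp]: "\<And>j. j \<in> Obj J \<Longrightarrow> c j \<in> Arr C"
      "\<And>j. j \<in> Obj J \<Longrightarrow> Dom C (c j) = fst (FObj D j)" "\<And>j. j \<in> Obj J \<Longrightarrow> Cod C (c j) = L"
    and c_nat: "\<And>u. u \<in> Arr J \<Longrightarrow> c (Cod J u) \<cdot> fst (snd (FArr D u)) = c (Dom J u)"
    using L by (auto simp: is_colimit_def is_cocone_def underlying_def)
  obtain F \<eta> where F: "is_monoid C F" and eta: "\<eta> \<in> hom C L (fst F)"
    and ext: "\<And>N f. is_monoid C N \<Longrightarrow> f \<in> hom C L (fst N) \<Longrightarrow> \<exists>h. monoid_hom C F N h \<and> h \<cdot> \<eta> = f"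
    and ext_unique: "\<And>N h k. is_monoid C N \<Longrightarrow> monoid_hom C F N h \<Longrightarrow> monoid_hom C F N k \<Longrightarrow> h \<cdot> \<eta> = k \<cdot> \<eta> \<Longrightarrow> h = k"
    using free_monoid_exists[OF cop L_obj] by blast
  have [simp]: "\<eta> \<in> Arr C" "Dom C \<eta> = L" "Cod C \<eta> = fst F" using eta by simp_all
  define S where "S = {(h, N). is_monoid C N \<and> monoid_hom C F N h \<and>
    (\<forall>j \<in> Obj J. monoid_hom C (FObj D j) N (h \<cdot> (\<eta> \<cdot> c j)))}"
  obtain E e where E: "is_monoid C E" and e: "monoid_hom C F E e" "epi e"
    and fact: "\<And>h P. (h, P) \<in> S \<Longrightarrow> \<exists>k. monoid_hom C E P k \<and> k \<cdot> e = h"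
    and joint: "\<And>r s. r \<in> Arr C \<Longrightarrow> s \<in> Arr C \<Longrightarrow> Dom C r = Dom C s \<Longrightarrow> Cod C r = fst E \<Longrightarrow> Cod C s = fst E \<Longrightarrow>
       (\<And>h P k. (h, P) \<in> S \<Longrightarrow> monoid_hom C E P k \<Longrightarrow> k \<cdot> e = h \<Longrightarrow> k \<cdot> r = k \<cdot> s) \<Longrightarrow> r = s"
    using monoid_image[OF F, of S] unfolding S_def by (smt (verit) case_prodD mem_Collect_eq)
  note [simp] = monoid_hom_typing[OF e(1)]
  define d where "d j = e \<cdot> (\<eta> \<cdot> c j)" for j
  have dt [simp]: "d j \<in> Arr C" "Dom C (d j) = fst (FObj D j)" "Cod C (d j) = fst E" if "j \<in> Obj J" for j
    using that by (simp_all add: d_def)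
  have d_hom: "monoid_hom C (FObj D j) E (d j)" if j: "j \<in> Obj J" for j
  proof -
    note [simp] = monoid_typing[OF D_mon[OF j]] monoid_typing[OF E] j
    have reflect: "k \<cdot> (d j \<cdot> fst (snd (FObj D j))) = k \<cdot> (fst (snd E) \<cdot> (d j \<otimes> d j))"
        "k \<cdot> (d j \<cdot> snd (snd (FObj D j))) = k \<cdot> snd (snd E)"
      if hP: "(h, P) \<in> S" and k: "monoid_hom C E P k" "k \<cdot> e = h" for h P k
    proof -
      have kd: "k \<cdot> d j = h \<cdot> (\<eta> \<cdot> c j)"
        unfolding k(2)[symmetric] d_def using monoid_hom_typing[OF k(1)] by simp
      have "monoid_hom C (FObj D j) P (h \<cdot> (\<eta> \<cdot> c j))" "is_monoid C P"
        using hP j unfolding S_def by blast+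
      then have hom: "monoid_hom C (FObj D j) P (k \<cdot> d j)" and P: "is_monoid C P"
        by (simp_all only: kd)
      show "k \<cdot> (d j \<cdot> fst (snd (FObj D j))) = k \<cdot> (fst (snd E) \<cdot> (d j \<otimes> d j))"
        "k \<cdot> (d j \<cdot> snd (snd (FObj D j))) = k \<cdot> snd (snd E)"
        using monoid_hom_reflect[OF k(1) hom dt[OF j] D_mon[OF j] E P] by blast+
    qed
    show ?thesis
    proof (rule monoid_homI[OF D_mon[OF j] E])
      show "d j \<cdot> fst (snd (FObj D j)) = fst (snd E) \<cdot> (d j \<otimes> d j)"
        by (rule joint) (fact reflect(1) | simp)+
      show "d j \<cdot> snd (snd (FObj D j)) = snd (snd E)"
        by (rule joint) (fact reflect(2) | simp)+
    qed simp_all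
  qed
  have "is_colimit J (Mon C) D E (\<lambda>j. (FObj D j, d j, E))"
    unfolding is_colimit_def
  proof (intro conjI allI impI)
    show "is_cocone J (Mon C) D E (\<lambda>j. (FObj D j, d j, E))"
      unfolding is_cocone_def
    proof (intro conjI ballI)
      fix u assume u: "u \<in> Arr J"
      then have o: "Dom J u \<in> Obj J" "Cod J u \<in> Obj J" using category.dom_obj category.cod_obj J by fast+
      have "FArr D u \<in> hom (Mon C) (FObj D (Dom J u)) (FObj D (Cod J u))"
        using D u by (simp add: is_functor_def)
      then obtain f where f: "FArr D u = (FObj D (Dom J u), f, FObj D (Cod J u))"
        "monoid_hom C (FObj D (Dom J u)) (FObj D (Cod J u)) f"
        unfolding Mon_hom by blast
      have "d (Cod J u) \<cdot> f = e \<cdot> (\<eta> \<cdot> (c (Cod J u) \<cdot> f))"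
        unfolding d_def using o monoid_hom_typing[OF f(2)] by simp
      also have "\<dots> = d (Dom J u)" using c_nat[OF u] by (simp add: f d_def)
      finally show "(FObj D (Cod J u), d (Cod J u), E) \<cdot>\<^bsub>Mon C\<^esub> FArr D u = (FObj D (Dom J u), d (Dom J u), E)"
        by (simp add: f)
    qed (use E D_mon d_hom in \<open>simp_all add: Mon_hom\<close>)
  next
    fix R l assume Rl: "is_cocone J (Mon C) D R l"
    then have R: "is_monoid C R" by (simp add: is_cocone_def)
    define l' where "l' j = fst (snd (l j))" for j
    have l: "l j = (FObj D j, l' j, R)" "monoid_hom C (FObj D j) R (l' j)" if "j \<in> Obj J" for j
      using Rl that by (auto simp: is_cocone_def Mon_hom l'_def)
    have "is_cocone J C ?U (fst R) l'"
      unfolding is_cocone_def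
    proof (intro conjI ballI)
      fix u assume u: "u \<in> Arr J"
      then have o: "Dom J u \<in> Obj J" "Cod J u \<in> Obj J" using category.dom_obj category.cod_obj J by fast+
      have "l (Cod J u) \<cdot>\<^bsub>Mon C\<^esub> FArr D u = l (Dom J u)" using Rl u by (simp add: is_cocone_def)
      then show "l' (Cod J u) \<cdot> FArr ?U u = l' (Dom J u)"
        using l[OF o(1)] l[OF o(2)] by (cases "FArr D u") (simp add: underlying_def)
    qed (use monoid_typing[OF R] monoid_hom_typing[OF l(2)] in \<open>simp_all add: underlying_def\<close>)
    then obtain t where t: "t \<in> hom C L (fst R)" "\<And>j. j \<in> Obj J \<Longrightarrow> t \<cdot> c j = l' j"
      and t_unique: "\<And>s. s \<in> hom C L (fst R) \<Longrightarrow> (\<forall>j \<in> Obj J. s \<cdot> c j = l' j) \<Longrightarrow> s = t"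
      using L unfolding is_colimit_def by metis
    obtain h where h: "monoid_hom C F R h" "h \<cdot> \<eta> = t" using ext[OF R t(1)] by blast
    note [simp] = monoid_hom_typing[OF h(1)]
    have "h \<cdot> (\<eta> \<cdot> c j) = l' j" if "j \<in> Obj J" for j
      using comp_eq_extend[OF h(2), of "c j"] t(2)[OF that] that by simp
    then have "(h, R) \<in> S" using R h(1) l(2) by (simp add: S_def)
    from fact[OF this] obtain k where k: "monoid_hom C E R k" "k \<cdot> e = h" by blast
    show "\<exists>!H. H \<in> hom (Mon C) E R \<and> (\<forall>j\<in>Obj J. H \<cdot>\<^bsub>Mon C\<^esub> (FObj D j, d j, E) = l j)"
    proof (rule ex1I[of _ "(E, k, R)"])
      have "k \<cdot> d j = l' j" if "j \<in> Obj J" for j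
        using comp_eq_extend[OF k(2), of "\<eta> \<cdot> c j"] comp_eq_extend[OF h(2), of "c j"] t(2)[OF that] that
          monoid_hom_typing[OF k(1)] by (simp add: d_def)
      then show "(E, k, R) \<in> hom (Mon C) E R \<and> (\<forall>j\<in>Obj J. (E, k, R) \<cdot>\<^bsub>Mon C\<^esub> (FObj D j, d j, E) = l j)"
        using k E R l(1) by (simp add: Mon_hom)
    next
      fix H assume "H \<in> hom (Mon C) E R \<and> (\<forall>j\<in>Obj J. H \<cdot>\<^bsub>Mon C\<^esub> (FObj D j, d j, E) = l j)"
      then obtain k' where H: "H = (E, k', R)" and k': "monoid_hom C E R k'"
        and k'd: "\<And>j. j \<in> Obj J \<Longrightarrow> k' \<cdot> d j = l' j"
        by (auto simp: Mon_hom l)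
      note [simp] = monoid_hom_typing[OF k']
      have "(k' \<cdot> e) \<cdot> \<eta> = t"
        by (rule t_unique) (use k'd in \<open>simp_all add: d_def\<close>)
      then have "k' \<cdot> e = h"
        using ext_unique[OF R monoid_hom_comp[OF e(1) k' F E R] h(1)] h(2) by simp
      then have eq: "k' \<cdot> e = k \<cdot> e" by (simp only: k(2))
      have "k' = k"
        by (rule epiD[OF e(2) _ _ _ _ eq]) (simp_all add: monoid_hom_typing[OF k(1)])
      then show "H = (E, k, R)" by (simp add: H)
    qed
  qed
  then show "\<exists>Q k. is_colimit J (Mon C) D Q k" by blast
qed

end

theorem proposition9:
  fixes C :: "('o, 'a) monoidal_cat" and small :: "'s set \<Rightarrow> bool"
  assumes "monoidal_category C"
    and "has_regular_factorizations C"
    and "has_countable_coproducts C"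
    and "tensor_preserves_countable_coproducts C"
    and "tensor_preserves_regular_epis C"
  shows "has_coequalizers (Mon C) \<and>
    (\<forall>J :: ('s, 's) cat. small_category small J \<longrightarrow>
       has_colimits_of_shape J C \<longrightarrow> has_colimits_of_shape J (Mon C)) \<and>
    (cocomplete small C \<longrightarrow> cocomplete small (Mon C))"
proof -
  interpret regular_monoidal_category C
    using assms by (simp add: regular_monoidal_category_def regular_monoidal_category_axioms_def)
  have "has_colimits_of_shape J (Mon C)"
    if "small_category small J" "has_colimits_of_shape J C" for J :: "('s, 's) cat"
    by (rule Mon_has_colimits[OF assms(3,4)]) (use that in \<open>auto simp only: small_category_def\<close>)
  then show ?thesis
    using Mon_has_coequalizers by (auto simp: cocomplete_def)
qed

end
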